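(* Let $K$ be an algebraically closed field of characteristic $0$. For a finite set $A=\{a_1,\dots,a_n\}\subset K$ of $n$ distinct elements, let $$A^+=\Big\{\sum_{i=1}^n\epsilon_ia_i:\ \epsilon_i\in\{0,1\}\Big\},\qquad A^\times=\Big\{\prod_{i=1}^n a_i^{\epsilon_i}:\ \epsilon_i\in\{0,1\}\Big\},$$ and for a positive integer $N$ let $g_K(N)=\min\{|A^+|+|A^\times| : A\subset K,\ |A|=N\}$. Then for every $\epsilon>0$ and every sufficiently large $N$ (depending on $\epsilon$), $$g_K(N)\geq N^{\left(\frac{1}{264}-\epsilon\right)\frac{\log\log N}{\log\log\log N}}.$$
   Context: $A^+$ is the set of sums of distinct elements of $A$ (including the empty sum) and $A^\times$ the set of products of distinct elements of $A$ (including the empty product). *)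

theory Defs
  imports "HOL-Computational_Algebra.Computational_Algebra"
begin

definition subset_sums :: "'a::comm_monoid_add set \<Rightarrow> 'a set" where
  "subset_sums A = {\<Sum>B | B. B \<subseteq> A}"

definition subset_prods :: "'a::comm_monoid_mult set \<Rightarrow> 'a set" where
  "subset_prods A = {\<Prod>B | B. B \<subseteq> A}"

definition g_K :: "('a::{comm_monoid_add,comm_monoid_mult}) itself \<Rightarrow> nat \<Rightarrow> nat" where
  "g_K (_ :: 'a itself) N = (LEAST k. \<exists>A :: 'a set.
       finite A \<and> card A = N \<and> k = card (subset_sums A) + card (subset_prods A))"

end

theory Submission
  imports Defs "HOL-Real_Asymp.Real_Asymp"
begin

text \<open>
  Suppose that \<open>|A\<^sup>+|\<close> and \<open>|A\<^sup>\<times>|\<close> are both less than \<open>N\<^sup>T\<close>.  Multiplying disjoint blocks of elements of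
  \<open>A\<close> one after the other yields product sets that eventually stop growing, and an isoperimetric
  inequality then forces half of \<open>A\<close> to have ratios of multiplicative rank \<open>O(T)\<close>.  On the other
  hand, elements of pairwise different size with respect to a valuation ring (or of sufficiently
  different modulus at a complex embedding) have distinct subset sums, so at every place \<open>A\<close> falls
  into at most \<open>O(T log N)\<close> classes.  Passing to popular classes at \<open>O(T)\<close> well-chosen places gives a
  large subset all of whose ratios are algebraic units with all conjugates very close to the unit
  circle.  If \<open>\<Sum> \<epsilon>\<^sub>i u\<^sub>i = 0\<close> for such units then \<open>\<Sum> \<epsilon>\<^sub>i u\<^sub>i\<^sup>p\<close> is \<open>p\<close> times an algebraic integer whose
  conjugates are all smaller than 1, hence zero; iterating over primes gives
  \<open>\<Sum> \<epsilon>\<^sub>i u\<^sub>i\<^bsup>1+qj\<^esup> = 0\<close> for many \<open>j\<close>, and a Vandermonde argument shows that the relation only involves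
  units differing by roots of unity of order \<open>q\<close>.  After removing these, all \<open>O(T)\<close>-fold subset sums are
  distinct, which contradicts the bound on \<open>|A\<^sup>+|\<close>.
\<close>

section \<open>Isoperimetry in multiplicative lattices\<close>

text \<open>The field may contain transcendentals and may be too large to embed into the complex
  numbers. Valuation rings of the whole field treat finite places and transcendental directions
  alike: an element lies in all of them iff it is an algebraic integer, and only the ring of
  algebraic integers is ever mapped to the complex numbers. Low rank bounds the number of places. At
  each place used, the chosen ratio is large while the surviving ratios are units there, or close to
  modulus 1; so it is independent of them and the rank drops. At complex places each step weakens
  independence by a factor \<open>\<eta> / 6\<close>, hence the classes are as fine as
  \<open>(\<eta> / 6) ^ r / 4\<close>. The primes limit \<open>T\<close>. With
  \<open>h = 5 T\<close>, relations have up to \<open>2 h\<close> terms, the primes must exceed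
  twice their number, and \<open>q = (4 h)!\<close> makes every \<open>1 + q j\<close> free of
  smaller ones. Exponents then reach \<open>X = 1 + 2 h q\<close>, logarithms of conjugates must be
  at most \<open>1 / (2 X)\<close>, and a loss of about \<open>X ^ (r ^ 2)\<close> arises, which is
  small against \<open>N\<close> when \<open>q \<le> ln N\<close>.\<close>

definition mult_indep :: "nat \<Rightarrow> (nat \<Rightarrow> 'a::field) \<Rightarrow> bool" where
  "mult_indep r w \<longleftrightarrow> (\<forall>n::nat \<Rightarrow> int. (\<Prod>i<r. w i powi n i) = 1 \<longrightarrow> (\<forall>i<r. n i = 0))"

lemma mult_indep_single:
  fixes w :: "nat \<Rightarrow> 'a::field"
  assumes "mult_indep r w" "i < r" "w i powi n = 1"
  shows "n = 0"
proof -
  have "(\<Prod>j<r. w j powi (if j = i then n else 0)) = (\<Prod>j\<in>{i}. w j powi n)"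
    by (rule prod.mono_neutral_cong_right) (use assms in auto)
  then have "(\<Prod>j<r. w j powi (if j = i then n else 0)) = 1"
    using assms by simp
  then have "\<forall>j<r. (if j = i then n else 0) = 0"
    using assms(1) unfolding mult_indep_def by (elim allE[of _ "\<lambda>j. if j = i then n else 0"]) simp
  then show ?thesis using assms(2) by auto
qed

definition line :: "'a::field \<Rightarrow> 'a \<Rightarrow> 'a set" where
  "line w x = range (\<lambda>n::int. x * w powi n)"

lemma line_self: "x \<in> line w x"
  unfolding line_def by (rule image_eqI[of _ _ 0]) auto

lemma line_eq:
  assumes "w \<noteq> 0" "y \<in> line w x"
  shows "line w y = line w x"
proof -
  obtain m where m: "y = x * w powi m" using assms unfolding line_def by auto
  have "line w y \<subseteq> line w x"
    unfolding line_def m by (auto simp: mult.assoc power_int_add[symmetric] assms)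
  moreover have "x * w powi n = y * w powi (n - m)" for n
    unfolding m using assms(1) by (simp add: mult.assoc power_int_add[symmetric])
  then have "line w x \<subseteq> line w y"
    unfolding line_def by auto
  ultimately show ?thesis by simp
qed

lemma powi_inj:
  fixes w :: "'a::field"
  assumes "w \<noteq> 0" "\<And>n. w powi n = 1 \<Longrightarrow> n = 0" "w powi m = w powi n"
  shows "m = n"
proof -
  have "w powi (m - n) = 1" using assms by (simp add: power_int_diff)
  then show ?thesis using assms(2)[of "m - n"] by simp
qed

text \<open>The powers of \<open>w\<close> are distinct, so walking from a point of the finite set
  \<open>S\<close> by repeated multiplication with \<open>w\<close> must exit. The last point before
  the first exit is a boundary point on the same line, so boundary points represent all
  lines.\<close>

lemma card_lines_le:
  fixes w :: "'a::field"
  assumes "finite S" "0 \<notin> S" "w \<noteq> 0" and ord: "\<And>n. w powi n = 1 \<Longrightarrow> n = 0"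
  shows "card (line w ` S) \<le> card {x\<in>S. x * w \<notin> S}"
proof -
  have "line w ` S \<subseteq> line w ` {x\<in>S. x * w \<notin> S}"
  proof
    fix l assume "l \<in> line w ` S"
    then obtain x where x: "x \<in> S" "l = line w x" by auto
    have "\<exists>n. x * w ^ n \<notin> S"
    proof (rule ccontr)
      assume "\<not> ?thesis"
      then have "range (\<lambda>n. x * w ^ n) \<subseteq> S" by auto
      moreover have "inj (\<lambda>n. x * w ^ n)"
      proof (rule injI)
        fix m n assume "x * w ^ m = x * w ^ n"
        then have "w powi int m = w powi int n" using x assms(2) by auto
        then have "int m = int n" using powi_inj[OF assms(3)] ord by blast
        then show "m = n" by simp
      qed
      ultimately show False
        using assms(1) finite_subset infinite_UNIV_nat finite_imageD by blast
    qed
    define n where "n = (LEAST n. x * w ^ n \<notin> S)"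
    have n: "x * w ^ n \<notin> S" unfolding n_def using \<open>\<exists>n. _\<close> by (rule LeastI_ex)
    then obtain m where m: "n = Suc m" using x(1) by (cases n) auto
    have "x * w ^ m \<in> S" using not_less_Least[of m "\<lambda>n. x * w ^ n \<notin> S"] m n_def by auto
    moreover have "x * w ^ m * w \<notin> S" using n m by (simp add: mult_ac)
    moreover have "x * w ^ m \<in> line w x"
      unfolding line_def by (rule image_eqI[of _ _ "int m"]) auto
    then have "line w (x * w ^ m) = l" using line_eq[OF assms(3)] x by auto
    ultimately show "l \<in> line w ` {x\<in>S. x * w \<notin> S}" by blast
  qed
  then have "card (line w ` S) \<le> card (line w ` {x\<in>S. x * w \<notin> S})"
    using assms(1) by (intro card_mono) auto
  also have "\<dots> \<le> card {x\<in>S. x * w \<notin> S}"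
    using assms(1) by (intro card_image_le) auto
  finally show ?thesis .
qed

text \<open>By independence, the \<open>L\<close> or more points on a line in direction
  \<open>j\<close> lie in different cosets of the lattice spanned by the earlier directions. Their
  grids are therefore disjoint and the counts add up.\<close>

lemma card_grid_ge:
  fixes w :: "nat \<Rightarrow> 'a::field"
  assumes "finite S" "0 \<notin> S" "mult_indep r w" "\<And>i. i < r \<Longrightarrow> w i \<noteq> 0"
    and long: "\<And>i x. i < r \<Longrightarrow> x \<in> S \<Longrightarrow> card (line (w i) x \<inter> S) \<ge> L"
  shows "j \<le> r \<Longrightarrow> x \<in> S \<Longrightarrow> card {y\<in>S. \<exists>n. y = x * (\<Prod>i<j. w i powi n i)} \<ge> L ^ j"
proof (induction j arbitrary: x)
  case 0
  have "{y \<in> S. \<exists>n::nat\<Rightarrow>int. y = x * (\<Prod>i<0. w i powi n i)} = {x}" using 0 by auto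
  then show ?case by simp
next
  case (Suc j)
  let ?Y = "\<lambda>j x. {y\<in>S. \<exists>n. y = x * (\<Prod>i<j. w i powi n i)}"
  have j: "j < r" using Suc by simp
  let ?l = "line (w j) x \<inter> S"
  have "(\<Union>y\<in>?l. ?Y j y) \<subseteq> ?Y (Suc j) x"
  proof clarsimp
    fix y n assume "y \<in> line (w j) x"
    then obtain m where "y = x * w j powi m" unfolding line_def by auto
    then show "\<exists>na. y * (\<Prod>i<j. w i powi n i) = x * ((\<Prod>i<j. w i powi na i) * w j powi na j)"
      by (intro exI[of _ "n(j:=m)"]) (simp add: mult_ac)
  qed
  moreover have "card (\<Union>y\<in>?l. ?Y j y) = (\<Sum>y\<in>?l. card (?Y j y))"
  proof (rule card_UN_disjoint)
    show "\<forall>y\<in>?l. \<forall>y'\<in>?l. y \<noteq> y' \<longrightarrow> ?Y j y \<inter> ?Y j y' = {}"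
    proof (intro ballI impI, rule ccontr)
      fix y y' assume y: "y \<in> ?l" "y' \<in> ?l" "y \<noteq> y'" and "?Y j y \<inter> ?Y j y' \<noteq> {}"
      then obtain n n' where eq: "y * (\<Prod>i<j. w i powi n i) = y' * (\<Prod>i<j. w i powi n' i)"
        by auto
      obtain m m' where m: "y = x * w j powi m" "y' = x * w j powi m'"
        using y unfolding line_def by auto
      have x0: "x \<noteq> 0" using Suc.prems assms(2) by auto
      let ?d = "\<lambda>i. if i < j then n i - n' i else if i = j then m - m' else 0"
      have wi: "w i \<noteq> 0" if "i < Suc j" for i using assms(4) that j by auto
      have "(\<Prod>i<r. w i powi ?d i) = (\<Prod>i<Suc j. w i powi ?d i)"
        by (rule prod.mono_neutral_right) (use j in auto)
      also have "\<dots> = (\<Prod>i<j. w i powi (n i - n' i)) * w j powi (m - m')"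
        by simp
      also have "(\<Prod>i<j. w i powi (n i - n' i)) = (\<Prod>i<j. w i powi n i / w i powi n' i)"
        by (rule prod.cong) (use wi in \<open>auto simp: power_int_diff\<close>)
      also have "\<dots> * w j powi (m - m') = 1"
        using eq x0 wi unfolding m prod_dividef
        by (simp add: power_int_diff field_simps)
      finally have "\<forall>i<r. ?d i = 0" using assms(3) unfolding mult_indep_def
        by (elim allE[of _ ?d]) simp
      then have "m = m'" using j by (metis eq_iff_diff_eq_0 less_irrefl)
      then show False using y m by auto
    qed
  qed (use assms(1) in auto)
  moreover have "(\<Sum>y\<in>?l. card (?Y j y)) \<ge> (\<Sum>y\<in>?l. L ^ j)"
    by (rule sum_mono) (use Suc j in auto)
  moreover have "(\<Sum>y\<in>?l. L ^ j) \<ge> L ^ Suc j"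
    using long[OF j Suc.prems(2)] by simp
  moreover have "card (\<Union>y\<in>?l. ?Y j y) \<le> card (?Y (Suc j) x)"
    by (rule card_mono) (use assms(1) calculation(1) in auto)
  ultimately show ?case by linarith
qed

text \<open>A subset of \<open>S\<close> maximising \<open>\<phi>\<close> meets every line through one of its points at least \<open>L\<close> times,
  as otherwise removing that line would increase \<open>\<phi>\<close>.\<close>

lemma isoperimetry:
  fixes w :: "nat \<Rightarrow> 'a::field"
  assumes S: "finite S" "0 \<notin> S" and w: "mult_indep r w" "\<And>i. i < r \<Longrightarrow> w i \<noteq> 0"
    and D: "\<And>i. i < r \<Longrightarrow> card {x\<in>S. x * w i \<notin> S} \<le> D" "r * D * L < card S"
  shows "L ^ r \<le> card S"
proof -
  define \<phi> :: "'a set \<Rightarrow> int" where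
    "\<phi> = (\<lambda>T. int (card T) - int L * (\<Sum>i<r. int (card (line (w i) ` T))))"
  have "finite (Pow S)" "Pow S \<noteq> {}" using S by auto
  then obtain T where T: "T \<subseteq> S" and max: "\<And>T'. T' \<subseteq> S \<Longrightarrow> \<phi> T' \<le> \<phi> T"
  proof -
    have "Max (\<phi> ` Pow S) \<in> \<phi> ` Pow S"
      using \<open>finite (Pow S)\<close> \<open>Pow S \<noteq> {}\<close> by (intro Max_in) auto
    then obtain T where "T \<subseteq> S" "\<phi> T = Max (\<phi> ` Pow S)" by auto
    with \<open>finite (Pow S)\<close> show ?thesis by (intro that[of T]) auto
  qed
  have fT: "finite T" using T S finite_subset by auto
  \<comment> \<open>Each direction has at most as many lines as boundary points, hence at most
    \<open>D\<close>; with \<open>r * D * L < card S\<close> this makes \<open>\<phi> S\<close>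
    positive, so the maximiser is nonempty.\<close>
  have "(\<Sum>i<r. int (card (line (w i) ` S))) \<le> (\<Sum>i<r. int D)"
  proof (rule sum_mono)
    fix i assume "i \<in> {..<r}"
    then show "int (card (line (w i) ` S)) \<le> int D"
      using card_lines_le[OF S w(2)[of i] mult_indep_single[OF w(1), of i]] D(1)[of i] by fastforce
  qed
  then have "int L * (\<Sum>i<r. int (card (line (w i) ` S))) \<le> int L * (int r * int D)"
    by (intro mult_left_mono) auto
  also have "\<dots> < int (card S)" using D(2)
    by (metis mult.commute of_nat_less_iff of_nat_mult)
  finally have "\<phi> S > 0" unfolding \<phi>_def by simp
  then have "\<phi> T > 0" using max[of S] by simp
  then have "T \<noteq> {}" unfolding \<phi>_def by auto
  then obtain x where x: "x \<in> T" by auto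
  have long: "card (line (w i) y \<inter> T) \<ge> L" if i: "i < r" and y: "y \<in> T" for i y
  proof -
    let ?l = "line (w i) y \<inter> T" let ?T' = "T - ?l"
    have c: "int (card ?T') = int (card T) - int (card ?l)"
      using fT by (subst card_Diff_subset) (auto intro!: of_nat_diff card_mono)
    have 1: "card (line (w j) ` ?T') \<le> card (line (w j) ` T)" for j
      by (intro card_mono image_mono) (use fT in auto)
    have "line (w i) ` ?T' \<subseteq> line (w i) ` T - {line (w i) y}"
      using line_self by fastforce
    then have "card (line (w i) ` ?T') \<le> card (line (w i) ` T - {line (w i) y})"
      by (intro card_mono) (use fT in auto)
    also have "\<dots> = card (line (w i) ` T) - 1" using y fT by (subst card_Diff_singleton) auto
    also have "card (line (w i) ` T) \<ge> 1" using y fT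
      by (metis Suc_leI One_nat_def card_gt_0_iff empty_iff finite_imageI image_is_empty)
    then have "int (card (line (w i) ` T) - 1) = int (card (line (w i) ` T)) - 1" by linarith
    finally have 2: "int (card (line (w i) ` ?T')) + 1 \<le> int (card (line (w i) ` T))"
      by linarith
    \<comment> \<open>Deleting \<open>?l\<close> removes at least one line in direction
      \<open>i\<close> and creates none in any direction, so \<open>\<phi>\<close> grows by at least
      \<open>L - card ?l\<close>, which maximality forces to be at most 0.\<close>
    have "(\<Sum>j<r. int (card (line (w j) ` ?T')) + (if j = i then 1 else 0))
        \<le> (\<Sum>j<r. int (card (line (w j) ` T)))"
      by (rule sum_mono) (use 1 2 in auto)
    then have "(\<Sum>j<r. int (card (line (w j) ` ?T'))) + 1 \<le> (\<Sum>j<r. int (card (line (w j) ` T)))"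
      using i by (simp add: sum.distrib)
    then have "int L * ((\<Sum>j<r. int (card (line (w j) ` ?T'))) + 1) \<le> int L * (\<Sum>j<r. int (card (line (w j) ` T)))"
      by (intro mult_left_mono) auto
    moreover have "\<phi> ?T' \<le> \<phi> T" using T by (intro max) auto
    ultimately show ?thesis unfolding \<phi>_def c by (simp add: algebra_simps)
  qed
  have "L ^ r \<le> card {y\<in>T. \<exists>n. y = x * (\<Prod>i<r. w i powi n i)}"
    using card_grid_ge[OF fT _ w long, of r x] T S x by auto
  also have "\<dots> \<le> card S" using S T by (intro card_mono) auto
  finally show ?thesis .
qed

section \<open>Growth of product sets and low multiplicative rank\<close>

definition ratios :: "'a::field set \<Rightarrow> 'a set" where
  "ratios A = {x / y | x y. x \<in> A \<and> y \<in> A}"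

definition has_indep_ratios :: "nat \<Rightarrow> 'a::field set \<Rightarrow> bool" where
  "has_indep_ratios r A \<longleftrightarrow> (\<exists>w. (\<forall>i<r. w i \<in> ratios A) \<and> mult_indep r w)"

lemma finite_subset_sums [simp]: "finite A \<Longrightarrow> finite (subset_sums A)"
  unfolding subset_sums_def by (simp add: setcompr_eq_image Collect_conj_eq flip: Pow_def)

lemma finite_subset_prods [simp]: "finite A \<Longrightarrow> finite (subset_prods A)"
  unfolding subset_prods_def by (simp add: setcompr_eq_image Collect_conj_eq flip: Pow_def)

lemma subset_sums_mono: "A \<subseteq> B \<Longrightarrow> subset_sums A \<subseteq> subset_sums B"
  unfolding subset_sums_def by auto

lemma subset_prods_mono: "A \<subseteq> B \<Longrightarrow> subset_prods A \<subseteq> subset_prods B"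
  unfolding subset_prods_def by auto

lemma subset_prods_nonzero:
  fixes A :: "'a::field set"
  assumes "finite A" "0 \<notin> A" shows "0 \<notin> subset_prods A"
  unfolding subset_prods_def using assms by (auto simp: prod_zero_iff finite_subset)

lemma subset_prods_mult:
  assumes "finite B" "s \<in> subset_prods B" "b \<notin> B" "b \<in> X"
  shows "s * b \<in> subset_prods (B \<union> X)"
proof -
  obtain C where C: "C \<subseteq> B" "s = \<Prod>C" using assms unfolding subset_prods_def by auto
  have "s * b = \<Prod>(insert b C)"
    using C assms finite_subset[of C B] by (subst prod.insert) (auto simp: mult.commute)
  then show ?thesis unfolding subset_prods_def using C assms by (intro CollectI exI[of _ "insert b C"]) auto
qed

text \<open>As \<open>S\<close> has fewer than \<open>L ^ r\<close> elements, isoperimetry yields a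
  direction \<open>x i / y i\<close> with at least \<open>card S / (r * L)\<close> boundary points.
  Translating all of \<open>S\<close> by \<open>y i\<close> and only the boundary by
  \<open>x i\<close> gives disjoint sets, whence the gain.\<close>

lemma product_set_growth:
  fixes x y :: "nat \<Rightarrow> 'a::field"
  assumes S: "finite S" "0 \<notin> S" "S \<noteq> {}" and r: "r \<ge> 1" "L \<ge> 1" and small: "card S < L ^ r"
    and nz: "\<And>i. i < r \<Longrightarrow> x i \<noteq> 0 \<and> y i \<noteq> 0"
    and ind: "mult_indep r (\<lambda>i. x i / y i)"
    and S': "finite S'" "\<And>s i. s \<in> S \<Longrightarrow> i < r \<Longrightarrow> s * x i \<in> S' \<and> s * y i \<in> S'"
  shows "real (card S') \<ge> (1 + 1 / real (r * L)) * real (card S)"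
proof -
  \<comment> \<open>The largest \<open>D\<close> with \<open>r * D * L < card S\<close>.\<close>
  define D where "D = (card S - 1) div (r * L)"
  have rL: "r * L > 0" using r by simp
  have cS: "card S > 0" using S by (simp add: card_gt_0_iff)
  have "D * (r * L) \<le> card S - 1" unfolding D_def by (rule div_times_less_eq_dividend)
  then have "r * D * L < card S" using cS by (simp add: mult_ac)
  then have "\<exists>i<r. card {s\<in>S. s * (x i / y i) \<notin> S} > D"
    using isoperimetry[OF S(1,2) ind, of D L] nz small by (meson divide_eq_0_iff not_less)
  then obtain i where i: "i < r" and D: "card {s\<in>S. s * (x i / y i) \<notin> S} > D" by auto
  let ?T = "{s\<in>S. s * (x i / y i) \<notin> S}"
  have "card S - 1 < card ?T * (r * L)"
    using D rL unfolding D_def by (simp add: div_less_iff_less_mult)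
  then have T: "real (card S) \<le> real (card ?T) * real (r * L)"
    using cS by (metis Suc_diff_1 Suc_leI of_nat_le_iff of_nat_mult)
  have "(\<lambda>s. s * y i) ` S \<union> (\<lambda>s. s * x i) ` ?T \<subseteq> S'" using S'(2) i by auto
  then have "card ((\<lambda>s. s * y i) ` S \<union> (\<lambda>s. s * x i) ` ?T) \<le> card S'"
    using S'(1) by (rule card_mono[rotated])
  moreover have "card ((\<lambda>s. s * y i) ` S \<union> (\<lambda>s. s * x i) ` ?T)
      = card ((\<lambda>s. s * y i) ` S) + card ((\<lambda>s. s * x i) ` ?T)"
  proof (rule card_Un_disjoint)
    show "(\<lambda>s. s * y i) ` S \<inter> (\<lambda>s. s * x i) ` ?T = {}"
    proof (rule ccontr)
      assume "\<not> ?thesis"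
      then obtain s t where "s \<in> S" "t \<in> ?T" "s * y i = t * x i" by blast
      then have "t * (x i / y i) = s" using nz[OF i] by (simp add: field_simps)
      then show False using \<open>s \<in> S\<close> \<open>t \<in> ?T\<close> by simp
    qed
  qed (use S in auto)
  moreover have "card ((\<lambda>s. s * y i) ` S) = card S"
    by (rule card_image) (use nz[OF i] in \<open>auto simp: inj_on_def\<close>)
  moreover have "card ((\<lambda>s. s * x i) ` ?T) = card ?T"
    by (rule card_image) (use nz[OF i] in \<open>auto simp: inj_on_def\<close>)
  ultimately have "real (card S) + real (card ?T) \<le> real (card S')" by linarith
  moreover have "real (card S) / real (r * L) \<le> real (card ?T)"
    using T rL by (simp add: divide_le_eq)
  ultimately show ?thesis by (simp add: algebra_simps)
qed

lemma low_rank_subset: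
  fixes A :: "'a::field set"
  assumes A: "finite A" "0 \<notin> A" and r: "r \<ge> 1" "L \<ge> 1" and big: "4 * r ^ 3 * L\<^sup>2 \<le> card A"
    and small: "card (subset_prods A) < L ^ r"
  shows "\<exists>B\<subseteq>A. card A \<le> 2 * card B \<and> \<not> has_indep_ratios r B"
proof (rule ccontr)
  assume neg: "\<not> ?thesis"
  let ?q = "1 + 1 / real (r * L)"
  have "\<exists>B S. B \<subseteq> A \<and> card B \<le> 2 * r * m \<and> S \<noteq> {} \<and> S \<subseteq> subset_prods B \<and> ?q ^ m \<le> real (card S)"
    if "m \<le> r * L * (r * L)" for m
    using that
  proof (induction m)
    case 0
    show ?case by (intro exI[of _ "{}"] exI[of _ "{1}"]) (auto simp: subset_prods_def)
  next
    case (Suc m)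
    then obtain B S where BS: "B \<subseteq> A" "card B \<le> 2 * r * m" "S \<noteq> {}" "S \<subseteq> subset_prods B"
      "?q ^ m \<le> real (card S)" by auto
    have fB: "finite B" using BS A finite_subset by auto
    have fS: "finite S" using BS fB finite_subset finite_subset_prods by blast
    have "4 * r * m \<le> 4 * r * (r * L * (r * L))" using Suc.prems by (intro mult_left_mono) auto
    also have "\<dots> \<le> card A" using big by (simp add: power2_eq_square power3_eq_cube mult_ac)
    finally have "2 * card B \<le> card A" using BS(2) by linarith
    then have "card A \<le> 2 * card (A - B)" using BS(1) fB by (simp add: card_Diff_subset)
    then have "has_indep_ratios r (A - B)" using neg by blast
    then obtain w where w: "\<forall>i<r. w i \<in> ratios (A - B)" "mult_indep r w"
      unfolding has_indep_ratios_def by auto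
    then have "\<forall>i. \<exists>p. i < r \<longrightarrow> fst p \<in> A - B \<and> snd p \<in> A - B \<and> w i = fst p / snd p"
      unfolding ratios_def mem_Collect_eq by (metis fst_conv snd_conv)
    then obtain p where p: "\<And>i. i < r \<Longrightarrow> fst (p i) \<in> A - B \<and> snd (p i) \<in> A - B \<and> w i = fst (p i) / snd (p i)"
      by metis
    define x y where "x = (\<lambda>i. fst (p i))" "y = (\<lambda>i. snd (p i))"
    have xy: "x i \<in> A - B" "y i \<in> A - B" "w i = x i / y i" if "i < r" for i
      using p[OF that] unfolding x_y_def by auto
    have "(\<Prod>i<r. w i powi n i) = (\<Prod>i<r. (x i / y i) powi n i)" for n
      by (rule prod.cong) (use xy in auto)
    then have ind: "mult_indep r (\<lambda>i. x i / y i)" using w(2) unfolding mult_indep_def by metis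
    define X where "X = x ` {..<r} \<union> y ` {..<r}"
    define S' where "S' = (\<lambda>(s, b). s * b) ` (S \<times> X)"
    have X: "X \<subseteq> A - B" unfolding X_def using xy by auto
    have fX: "finite X" unfolding X_def by auto
    have "card X \<le> card (x ` {..<r}) + card (y ` {..<r})" unfolding X_def by (rule card_Un_le)
    also have "\<dots> \<le> r + r" by (intro add_mono) (metis card_image_le card_lessThan finite_lessThan)+
    finally have cX: "card X \<le> 2 * r" by simp
    have S': "S' \<subseteq> subset_prods (B \<union> X)"
      unfolding S'_def using subset_prods_mult[OF fB] BS(4) X by fastforce
    have "S \<subseteq> subset_prods A" using BS subset_prods_mono by blast
    then have "card S < L ^ r" and S0: "0 \<notin> S"
      using small card_mono[of "subset_prods A" S] A finite_subset_prods subset_prods_nonzero by fastforce+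
    then have "real (card S') \<ge> ?q * real (card S)"
    proof (intro product_set_growth[OF fS _ _ r _ _ ind])
      show "finite S'" unfolding S'_def using fS fX by auto
      show "s * x i \<in> S' \<and> s * y i \<in> S'" if "s \<in> S" "i < r" for s i
        unfolding S'_def X_def using that by force
      show "x i \<noteq> 0 \<and> y i \<noteq> 0" if "i < r" for i using xy[OF that] A by auto
    qed (use BS in auto)
    moreover have "?q * real (card S) \<ge> ?q * ?q ^ m" using BS(5) by (intro mult_left_mono) auto
    ultimately have "?q ^ Suc m \<le> real (card S')" by simp
    moreover have "S' \<noteq> {}" unfolding S'_def X_def using BS r by (auto simp: lessThan_empty_iff)
    moreover have "card (B \<union> X) \<le> 2 * r * Suc m"
      using card_Un_le[of B X] BS(2) cX by simp
    ultimately show ?case using S' X BS(1) by (intro exI[of _ "B \<union> X"] exI[of _ S']) auto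
  qed
  from this[of "r * L * (r * L)"] obtain B S where BS: "B \<subseteq> A" "S \<subseteq> subset_prods B"
    "?q ^ (r * L * (r * L)) \<le> real (card S)" by auto
  have "1 + real (r * L) * (1 / real (r * L)) \<le> ?q ^ (r * L)"
    by (rule Bernoulli_inequality) (auto intro: order_trans[of _ 0])
  then have "2 \<le> ?q ^ (r * L)" using r by simp
  then have "2 ^ (r * L) \<le> (?q ^ (r * L)) ^ (r * L)" by (intro power_mono) auto
  also have "\<dots> \<le> real (card S)" using BS by (simp only: power_mult)
  also have "\<dots> \<le> real (card (subset_prods A))"
    using BS subset_prods_mono[OF BS(1)] A by (intro of_nat_mono card_mono) auto
  also have "\<dots> < real (L ^ r)" using small by simp
  also have "\<dots> \<le> (2 ^ L) ^ r" unfolding of_nat_power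
    by (intro power_mono) (use of_nat_less_two_power[of L, where 'a=real] in auto)
  finally show False by (simp flip: power_mult add: mult.commute)
qed

section \<open>Valuation rings\<close>

definition is_subring :: "'a::field set \<Rightarrow> bool" where
  "is_subring R \<longleftrightarrow> 1 \<in> R \<and> (\<forall>x\<in>R. \<forall>y\<in>R. x - y \<in> R \<and> x * y \<in> R)"

definition adjoin :: "'a::field set \<Rightarrow> 'a \<Rightarrow> 'a set" where
  "adjoin R x = {poly p x | p. \<forall>i. coeff p i \<in> R}"

context
  fixes R :: "'a::field set"
  assumes R: "is_subring R"
begin

lemma subring_1: "1 \<in> R" and subring_diff: "x \<in> R \<Longrightarrow> y \<in> R \<Longrightarrow> x - y \<in> R"
  and subring_mult: "x \<in> R \<Longrightarrow> y \<in> R \<Longrightarrow> x * y \<in> R"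
  using R unfolding is_subring_def by auto

lemma subring_0: "0 \<in> R" using subring_diff[OF subring_1 subring_1] by simp

lemma subring_minus: "x \<in> R \<Longrightarrow> - x \<in> R" using subring_diff[OF subring_0] by simp

lemma subring_add: "x \<in> R \<Longrightarrow> y \<in> R \<Longrightarrow> x + y \<in> R"
  using subring_diff[OF _ subring_minus, of x y] by simp

lemma subring_power: "x \<in> R \<Longrightarrow> x ^ n \<in> R"
  by (induction n) (auto intro: subring_1 subring_mult)

lemma subring_sum: "(\<And>i. i \<in> I \<Longrightarrow> f i \<in> R) \<Longrightarrow> sum f I \<in> R"
  by (induction I rule: infinite_finite_induct) (auto intro: subring_0 subring_add)

lemma subring_of_nat: "of_nat n \<in> R"
  by (induction n) (auto intro: subring_0 subring_1 subring_add)

lemma subring_of_int: "of_int n \<in> R"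
  by (cases n rule: int_cases2) (auto intro: subring_of_nat subring_minus)

lemma coeffs_minus: "\<forall>i. coeff p i \<in> R \<Longrightarrow> \<forall>i. coeff q i \<in> R \<Longrightarrow> \<forall>i. coeff (p - q) i \<in> R"
  by (auto intro: subring_diff)

lemma coeffs_mult: "\<forall>i. coeff p i \<in> R \<Longrightarrow> \<forall>i. coeff q i \<in> R \<Longrightarrow> \<forall>i. coeff (p * q) i \<in> R"
  by (auto simp: coeff_mult intro!: subring_sum subring_mult)

lemma coeffs_pCons: "a \<in> R \<Longrightarrow> \<forall>i. coeff p i \<in> R \<Longrightarrow> \<forall>i. coeff (pCons a p) i \<in> R"
  by (auto simp: coeff_pCons split: nat.splits)

lemma coeffs_monom: "a \<in> R \<Longrightarrow> \<forall>i. coeff (monom a n) i \<in> R"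
  by (auto intro: subring_0)

lemma subring_poly: "\<forall>i. coeff p i \<in> R \<Longrightarrow> x \<in> R \<Longrightarrow> poly p x \<in> R"
  unfolding poly_altdef by (auto intro!: subring_sum subring_mult subring_power)

lemma is_subring_adjoin: "is_subring (adjoin R x)"
  unfolding is_subring_def
proof (intro conjI ballI)
  show "1 \<in> adjoin R x"
    unfolding adjoin_def using coeffs_pCons[OF subring_1, of 0] subring_0
    by (intro CollectI exI[of _ "[:1:]"]) simp
next
  fix a b assume "a \<in> adjoin R x" "b \<in> adjoin R x"
  then obtain p q where "a = poly p x" "b = poly q x" "\<forall>i. coeff p i \<in> R" "\<forall>i. coeff q i \<in> R"
    unfolding adjoin_def by auto
  note pq = this
  show "a - b \<in> adjoin R x"
    unfolding adjoin_def using coeffs_minus[of p q] pq by (intro CollectI exI[of _ "p - q"]) simp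
  show "a * b \<in> adjoin R x"
    unfolding adjoin_def using coeffs_mult[of p q] pq by (intro CollectI exI[of _ "p * q"]) simp
qed

lemma subset_adjoin: "R \<subseteq> adjoin R x"
proof
  fix a assume "a \<in> R"
  then have "\<forall>i. coeff [:a:] i \<in> R" using coeffs_pCons[of a 0] subring_0 by auto
  then show "a \<in> adjoin R x" unfolding adjoin_def by (intro CollectI exI[of _ "[:a:]"]) auto
qed

lemma in_adjoin: "x \<in> adjoin R x"
proof -
  have "\<forall>i. coeff [:0, 1:] i \<in> R"
    using coeffs_pCons[OF subring_0, of "[:1:]"] coeffs_pCons[OF subring_1, of 0] subring_0 by auto
  then show ?thesis unfolding adjoin_def by (intro CollectI exI[of _ "[:0, 1:]"]) auto
qed

end

lemma is_subring_Union_chain: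
  assumes "C \<noteq> {}" "\<And>R. R \<in> C \<Longrightarrow> is_subring R" "\<And>R R'. R \<in> C \<Longrightarrow> R' \<in> C \<Longrightarrow> R \<subseteq> R' \<or> R' \<subseteq> R"
  shows "is_subring (\<Union>C)"
  unfolding is_subring_def
proof (intro conjI ballI)
  show "1 \<in> \<Union>C" using assms subring_1 by blast
next
  fix x y assume "x \<in> \<Union>C" "y \<in> \<Union>C"
  then obtain R where "R \<in> C" "x \<in> R" "y \<in> R" using assms(3) by blast
  then show "x - y \<in> \<Union>C" "x * y \<in> \<Union>C" using assms(2) subring_diff subring_mult by blast+
qed

definition valuation_ring :: "'a::field set \<Rightarrow> bool" where
  "valuation_ring R \<longleftrightarrow> is_subring R \<and> (\<forall>x. x \<noteq> 0 \<longrightarrow> x \<in> R \<or> inverse x \<in> R)"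

lemma is_subring_Ints: "is_subring (\<int> :: 'a::field set)"
  unfolding is_subring_def by auto

lemma valuation_ring_integrally_closed:
  assumes V: "valuation_ring R" and x: "algebraic_int x"
  shows "x \<in> R"
proof (cases "x = 0 \<or> x \<in> R")
  case True
  then show ?thesis using V subring_0 unfolding valuation_ring_def by auto
next
  case False
  then have x0: "x \<noteq> 0" and inv: "inverse x \<in> R" using V unfolding valuation_ring_def by auto
  have R: "is_subring R" using V unfolding valuation_ring_def by simp
  obtain p where p: "lead_coeff p = 1" "\<forall>i. coeff p i \<in> \<int>" "poly p x = 0"
    using x by (auto elim: algebraic_int.cases)
  have "degree p \<noteq> 0" 
  proof
    assume "degree p = 0"
    then obtain c where "p = [:c:]" by (rule degree_eq_zeroE)
    then show False using p by simp
  qed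
  then obtain n where n: "degree p = Suc n" by (cases "degree p") auto
  have pR: "coeff p i \<in> R" for i
    using p(2)[rule_format, of i] subring_of_int[OF R] by (auto elim!: Ints_cases)
  have "0 = poly p x * inverse x ^ n" using p by simp
  also have "\<dots> = (\<Sum>i\<le>Suc n. coeff p i * x ^ i * inverse x ^ n)"
    unfolding poly_altdef n sum_distrib_right ..
  also have "\<dots> = (\<Sum>i\<le>n. coeff p i * x ^ i * inverse x ^ n) + x"
    using p(1) n x0 by (simp add: field_simps)
  also have "(\<Sum>i\<le>n. coeff p i * x ^ i * inverse x ^ n) = (\<Sum>i\<le>n. coeff p i * inverse x ^ (n - i))"
    by (rule sum.cong) (use x0 in \<open>auto simp: power_diff field_simps\<close>)
  finally have "x = - (\<Sum>i\<le>n. coeff p i * inverse x ^ (n - i))" by (simp add: eq_neg_iff_add_eq_0 add.commute)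
  moreover have "(\<Sum>i\<le>n. coeff p i * inverse x ^ (n - i)) \<in> R"
    by (intro subring_sum[OF R] subring_mult[OF R] subring_power[OF R] pR inv)
  ultimately show ?thesis using subring_minus[OF R] by metis
qed


text \<open>A relation \<open>y * poly p z = 1\<close> says that \<open>y\<close> becomes invertible
  in \<open>M[z]\<close>. In the relation for \<open>inverse z\<close> the number
  \<open>1 - y * coeff q 0\<close> is a unit of \<open>M\<close>; dividing by it and multiplying by
  \<open>z ^ degree q\<close> expresses this power of \<open>z\<close> through lower ones with an
  extra factor \<open>y\<close>, and that removes the leading term of \<open>p\<close>.\<close>

lemma lower_degree_relation:
  assumes M: "is_subring M" and y: "y \<in> M" and u: "\<And>d. d \<in> M \<Longrightarrow> inverse (1 - y * d) \<in> M"
    and ne: "\<And>d. d \<in> M \<Longrightarrow> y * d \<noteq> 1" and z: "z \<noteq> 0"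
    and p: "\<forall>i. coeff p i \<in> M" "y * poly p z = 1"
    and q: "\<forall>i. coeff q i \<in> M" "y * poly q (inverse z) = 1" and le: "degree q \<le> degree p"
  shows "\<exists>p'. (\<forall>i. coeff p' i \<in> M) \<and> y * poly p' z = 1 \<and> degree p' < degree p"
proof -
  define m n where "m = degree q" and "n = degree p"
  have "m \<noteq> 0"
  proof
    assume "m = 0"
    then obtain c where "q = [:c:]" unfolding m_def by (rule degree_eq_zeroE)
    then show False using q ne[of c] by (metis coeff_pCons_0 poly_const_conv)
  qed
  then obtain m' where m': "m = Suc m'" by (cases m) auto
  define v where "v = inverse (1 - y * coeff q 0)"
  have v: "v \<in> M" "v * (1 - y * coeff q 0) = 1"
    unfolding v_def using u ne q by auto
  \<comment> \<open>The reversal of \<open>q\<close> without its constant term, scaled by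
    \<open>v\<close>, so that \<open>z ^ m = y * poly g z\<close>.\<close>
  define g where "g = (\<Sum>i\<le>m'. monom (coeff q (Suc i) * v) (m' - i))"
  have g: "\<forall>i. coeff g i \<in> M" unfolding g_def coeff_sum
    using q v by (auto intro!: subring_sum[OF M] subring_mult[OF M] subring_0[OF M])
  have dg: "degree g \<le> m'" unfolding g_def
    by (intro degree_sum_le) (auto intro: order_trans[OF degree_monom_le])
  define T where "T = (\<Sum>i\<le>m'. coeff q (Suc i) * inverse z ^ Suc i)"
  have e1: "poly q (inverse z) = (\<Sum>i\<le>Suc m'. coeff q i * inverse z ^ i)"
    using m' by (simp add: poly_altdef m_def)
  have e2: "(\<Sum>i\<le>Suc m'. coeff q i * inverse z ^ i) = coeff q 0 + T"
    unfolding T_def sum.atMost_Suc_shift[of _ m'] by (simp only: power_0 mult_1_right)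
  have "1 - y * coeff q 0 = y * T"
    using q(2) unfolding e1 e2 distrib_left by (metis add_diff_cancel_left')
  then have "z ^ m * (1 - y * coeff q 0) = y * (z ^ m * T)"
    by (metis mult.left_commute)
  also have "z ^ m * T = (\<Sum>i\<le>m'. coeff q (Suc i) * z ^ (m' - i))"
    unfolding T_def sum_distrib_left m'
    by (rule sum.cong) (use z in \<open>auto simp: power_diff field_simps\<close>)
  finally have "z ^ m * (v * (1 - y * coeff q 0)) = y * (v * (\<Sum>i\<le>m'. coeff q (Suc i) * z ^ (m' - i)))"
    by (metis mult.left_commute)
  also have "v * (\<Sum>i\<le>m'. coeff q (Suc i) * z ^ (m' - i)) = poly g z"
    unfolding g_def poly_sum poly_monom sum_distrib_left by (simp add: mult_ac)
  finally have zm: "z ^ m = y * poly g z" using v by simp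
  define c where "c = coeff p n"
  define p' where "p' = p - (monom c n - monom (c * y) (n - m) * g)"
  have mn: "m \<le> n" using le unfolding m_def n_def .
  have "z ^ n = z ^ (n - m) * z ^ m" using mn by (simp flip: power_add)
  then have "poly p' z = poly p z" unfolding p'_def by (simp add: poly_monom zm)
  moreover have "\<forall>i. coeff p' i \<in> M"
    unfolding p'_def c_def by (intro coeffs_minus[OF M] coeffs_mult[OF M] coeffs_monom[OF M] subring_mult[OF M] y g p(1) p(1)[rule_format])
  moreover have "degree p' < n"
  proof -
    have "degree (p - monom c n) \<le> n - 1"
    proof (rule degree_le, intro allI impI)
      fix i assume "i > n - 1"
      then show "coeff (p - monom c n) i = 0"
        using m' mn by (cases "i = n") (auto simp: c_def n_def coeff_eq_0)
    qed
    moreover have "degree (monom (c * y) (n - m) * g) \<le> (n - m) + m'"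
      by (rule order_trans[OF degree_mult_le]) (intro add_mono dg degree_monom_le)
    then have "degree (monom (c * y) (n - m) * g) \<le> n - 1" using m' mn by simp
    moreover have "p' = (p - monom c n) + monom (c * y) (n - m) * g" unfolding p'_def by simp
    ultimately have "degree p' \<le> n - 1" using degree_add_le by metis
    then show ?thesis using m' mn by simp
  qed
  ultimately show ?thesis using p unfolding n_def by auto
qed

text \<open>\<open>M\<close> is maximal among the rings in which \<open>y\<close> is not invertible:
  adjoining any outside element inverts \<open>y\<close>. If neither \<open>z\<close> nor
  \<open>inverse z\<close> were in \<open>M\<close>, both would satisfy relations of least degree,
  and the one of larger degree could be shortened.\<close>

lemma valuation_ring_if_maximal:
  assumes M: "is_subring M" and y: "y \<in> M" and ne: "\<And>d. d \<in> M \<Longrightarrow> y * d \<noteq> 1"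
    and max: "\<And>z. z \<notin> M \<Longrightarrow> \<exists>p. (\<forall>i. coeff p i \<in> M) \<and> y * poly p z = 1"
  shows "valuation_ring M"
proof -
  have unit: "inverse (1 - y * d) \<in> M" if d: "d \<in> M" for d
  proof (rule ccontr)
    define u where "u = 1 - y * d"
    assume "inverse (1 - y * d) \<notin> M"
    then obtain p where p: "\<forall>i. coeff p i \<in> M" "y * poly p (inverse u) = 1" using max unfolding u_def by blast
    have u0: "u \<noteq> 0" using ne[OF d] unfolding u_def by auto
    have u: "u \<in> M" unfolding u_def by (intro subring_diff[OF M] subring_1[OF M] subring_mult[OF M] y d)
    \<comment> \<open>Powers of \<open>u\<close> are congruent to 1 modulo \<open>y\<close>, so
      clearing denominators in \<open>y * poly p (inverse u) = 1\<close> exhibits an inverse of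
      \<open>y\<close> already in \<open>M\<close>.\<close>
    have "\<exists>e\<in>M. u ^ n = 1 - y * e" for n
    proof (induction n)
      case 0 then show ?case using subring_0[OF M] by (intro bexI[of _ 0]) auto
    next
      case (Suc n)
      then obtain e where "e \<in> M" "u ^ n = 1 - y * e" by auto
      moreover have "u * (1 - y * e) = 1 - y * (d + e - y * (d * e))" unfolding u_def by (simp add: algebra_simps)
      ultimately show ?case
        using d y by (intro bexI[of _ "d + e - y * (d * e)"])
          (auto intro!: subring_diff[OF M] subring_add[OF M] subring_mult[OF M])
    qed
    then obtain e where e: "e \<in> M" "u ^ degree p = 1 - y * e" by blast
    let ?f = "\<Sum>i\<le>degree p. coeff p i * u ^ (degree p - i)"
    have "poly p (inverse u) * u ^ degree p = ?f"
      unfolding poly_altdef sum_distrib_right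
      by (rule sum.cong) (use u0 in \<open>auto simp: power_diff field_simps\<close>)
    then have "y * ?f = 1 - y * e" using p e by (metis mult.assoc mult_1)
    then have "y * (?f + e) = 1" by (simp add: algebra_simps)
    moreover have "?f + e \<in> M"
      by (intro subring_add[OF M] subring_sum[OF M] subring_mult[OF M] subring_power[OF M] u e p(1)[rule_format])
    ultimately show False using ne by blast
  qed
  have "z \<in> M \<or> inverse z \<in> M" if z: "z \<noteq> 0" for z
  proof (rule ccontr)
    let ?P = "\<lambda>z p. (\<forall>i. coeff p i \<in> M) \<and> y * poly p z = 1"
    assume neg: "\<not> ?thesis"
    obtain p0 q0 where "?P z p0" "?P (inverse z) q0" using max neg by blast
    then obtain p q where p: "?P z p" "\<And>p'. ?P z p' \<Longrightarrow> degree p \<le> degree p'"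
      and q: "?P (inverse z) q" "\<And>p'. ?P (inverse z) p' \<Longrightarrow> degree q \<le> degree p'"
      using ex_has_least_nat[of "?P z" p0 degree] ex_has_least_nat[of "?P (inverse z)" q0 degree]
      by blast
    show False
    proof (cases "degree q \<le> degree p")
      case True
      then have "\<exists>p'. ?P z p' \<and> degree p' < degree p"
        using lower_degree_relation[OF M y unit ne z, of p q] p q by auto
      then show False using p(2) by (meson not_less)
    next
      case False
      then have "\<exists>p'. ?P (inverse z) p' \<and> degree p' < degree q"
        using lower_degree_relation[OF M y unit ne, of "inverse z" q p] p q z by auto
      then show False using q(2) by (meson not_less)
    qed
  qed
  then show ?thesis unfolding valuation_ring_def using M by auto
qed

text \<open>Zorn's lemma provides a subring maximal among those containing
  \<open>y = inverse x\<close> as a non-unit, and such a ring cannot contain \<open>x\<close>. The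
  ring generated by \<open>y\<close> is a legitimate start: a relation
  \<open>y * poly p y = 1\<close> over the integers, read backwards, is a monic integer equation for
  \<open>x\<close>.\<close>

lemma exists_valuation_ring:
  fixes x :: "'a::field_char_0"
  assumes x: "\<not> algebraic_int x"
  shows "\<exists>R. valuation_ring R \<and> x \<notin> R"
proof -
  have x0: "x \<noteq> 0" using x by auto
  define y where "y = inverse x"
  define \<A> where "\<A> = {R. is_subring R \<and> y \<in> R \<and> (\<forall>a\<in>R. y * a \<noteq> 1)}"
  have "adjoin \<int> y \<in> \<A>"
  proof -
    have "y * poly p y \<noteq> 1" if p: "\<forall>i. coeff p i \<in> \<int>" for p
    proof
      assume eq: "y * poly p y = 1"
      have "algebraic_int (inverse y)"
      proof (rule algebraic_int_inverse)
        show "poly (1 - pCons 0 p) y = 0" using eq by simp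
        show "\<forall>i. coeff (1 - pCons 0 p) i \<in> \<int>"
          using p by (auto simp: coeff_pCons split: nat.splits)
        show "coeff (1 - pCons 0 p) 0 = 1" by simp
      qed
      then show False using x unfolding y_def by simp
    qed
    then have "\<forall>a\<in>adjoin \<int> y. y * a \<noteq> 1" unfolding adjoin_def by blast
    then show ?thesis unfolding \<A>_def
      using is_subring_adjoin[OF is_subring_Ints] in_adjoin[OF is_subring_Ints] by blast
  qed
  have "\<exists>M\<in>\<A>. \<forall>X\<in>\<A>. M \<subseteq> X \<longrightarrow> X = M"
  proof (rule subset_Zorn_nonempty)
    show "\<A> \<noteq> {}" using \<open>adjoin \<int> y \<in> \<A>\<close> by auto
  next
    fix C assume C: "C \<noteq> {}" "subset.chain \<A> C"
    have "is_subring (\<Union>C)"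
      by (rule is_subring_Union_chain) (use C in \<open>auto simp: subset_chain_def \<A>_def\<close>)
    then show "\<Union>C \<in> \<A>" using C unfolding subset_chain_def \<A>_def by blast
  qed
  then obtain M where M: "M \<in> \<A>" and max: "\<And>X. X \<in> \<A> \<Longrightarrow> M \<subseteq> X \<Longrightarrow> X = M" by blast
  have sub: "is_subring M" "y \<in> M" and ne: "\<And>d. d \<in> M \<Longrightarrow> y * d \<noteq> 1" using M unfolding \<A>_def by auto
  have "\<exists>p. (\<forall>i. coeff p i \<in> M) \<and> y * poly p z = 1" if "z \<notin> M" for z
  proof -
    have "adjoin M z \<notin> \<A>"
      using max[of "adjoin M z"] subset_adjoin[OF sub(1)] in_adjoin[OF sub(1)] that by metis
    moreover have "is_subring (adjoin M z)" "y \<in> adjoin M z"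
      using is_subring_adjoin[OF sub(1)] subset_adjoin[OF sub(1)] sub(2) by blast+
    ultimately obtain a where "a \<in> adjoin M z" "y * a = 1" unfolding \<A>_def by blast
    then show ?thesis unfolding adjoin_def by blast
  qed
  then have "valuation_ring M" using valuation_ring_if_maximal[OF sub ne] by blast
  moreover have "x \<notin> M" using ne[of x] x0 unfolding y_def by auto
  ultimately show ?thesis by blast
qed

lemma algebraic_int_iff_valuation_rings:
  fixes x :: "'a::field_char_0"
  shows "algebraic_int x \<longleftrightarrow> (\<forall>R. valuation_ring R \<longrightarrow> x \<in> R)"
  using valuation_ring_integrally_closed exists_valuation_ring by blast

text \<open>An intersection of rings is a ring; the description by valuation rings replaces
  resultants or finitely generated modules.\<close>

lemma is_subring_algebraic_int: "is_subring {x::'a::field_char_0. algebraic_int x}"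
  unfolding is_subring_def algebraic_int_iff_valuation_rings mem_Collect_eq
  by (auto simp: valuation_ring_def intro: subring_1 subring_diff subring_mult)

section \<open>Dissociated sets and classes at a valuation ring\<close>

lemma equal_sums_relation:
  fixes B C :: "'a::comm_ring_1 set"
  assumes "finite B" "finite C" "\<Sum>B = \<Sum>C" "B \<noteq> C"
  shows "\<exists>E \<epsilon>. E \<subseteq> B \<union> C \<and> E \<noteq> {} \<and> (\<forall>d\<in>E. \<epsilon> d \<in> {-1, 1::int}) \<and> (\<Sum>d\<in>E. of_int (\<epsilon> d) * d) = 0"
proof -
  let ?E = "(B - C) \<union> (C - B)" let ?\<epsilon> = "\<lambda>d. if d \<in> B then 1 else -1 :: int"
  have "(\<Sum>d\<in>?E. of_int (?\<epsilon> d) * d) = (\<Sum>d\<in>B - C. of_int (?\<epsilon> d) * d) + (\<Sum>d\<in>C - B. of_int (?\<epsilon> d) * d)"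
    by (rule sum.union_disjoint) (use assms in auto)
  also have "\<dots> = \<Sum>(B - C) - \<Sum>(C - B)" by (simp add: sum_negf)
  also have "\<dots> = \<Sum>B - \<Sum>C"
    using sum.Int_Diff[OF assms(1), of id C] sum.Int_Diff[OF assms(2), of id B] by (simp add: Int_commute)
  finally have "(\<Sum>d\<in>?E. of_int (?\<epsilon> d) * d) = 0" using assms by simp
  moreover have "?E \<subseteq> B \<union> C" "?E \<noteq> {}" using assms by blast+
  ultimately show ?thesis by (intro exI[of _ ?E] exI[of _ ?\<epsilon>]) simp
qed

text \<open>Two equal subset sums of \<open>D\<close> would leave a relation with signs, so all
  \<open>2 ^ card D\<close> of them are distinct. This is how the bound on the sums limits the
  number of classes at a place.\<close>

lemma dissociated_card_le:
  fixes D :: "'a::field_char_0 set"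
  assumes A: "finite A" "D \<subseteq> A" "card (subset_sums A) \<le> 2 ^ k"
    and diss: "\<And>E \<epsilon>. E \<subseteq> D \<Longrightarrow> E \<noteq> {} \<Longrightarrow> (\<And>d. d \<in> E \<Longrightarrow> \<epsilon> d \<in> {-1, 1::int}) \<Longrightarrow>
      (\<Sum>d\<in>E. of_int (\<epsilon> d) * d) \<noteq> 0"
  shows "card D \<le> k"
proof -
  have fD: "finite D" using A finite_subset by auto
  have "inj_on (\<lambda>B. \<Sum>B) (Pow D)"
  proof (rule inj_onI, rule ccontr)
    fix B C assume BC: "B \<in> Pow D" "C \<in> Pow D" and eq: "\<Sum>B = \<Sum>C" and ne: "B \<noteq> C"
    have fBC: "finite B" "finite C" using BC fD finite_subset by auto
    obtain E \<epsilon> where E: "E \<subseteq> B \<union> C" "E \<noteq> {}" "\<forall>d\<in>E. \<epsilon> d \<in> {-1, 1::int}" "(\<Sum>d\<in>E. of_int (\<epsilon> d) * d) = 0"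
      using equal_sums_relation[OF fBC eq ne] by blast
    moreover have "E \<subseteq> D" using E(1) BC by auto
    ultimately show False using diss[of E \<epsilon>] by blast
  qed
  then have "2 ^ card D = card (Sum ` Pow D)" using fD by (simp add: card_image card_Pow)
  also have "\<dots> \<le> card (subset_sums A)"
    by (rule card_mono) (use A in \<open>auto simp: subset_sums_def\<close>)
  also have "\<dots> \<le> 2 ^ k" by (rule A)
  finally show ?thesis by simp
qed

lemma popular_fibre:
  assumes "finite A" "card (f ` A) \<le> k"
  shows "\<exists>B\<subseteq>A. card A \<le> k * card B \<and> (\<forall>x\<in>B. \<forall>y\<in>B. f x = f y)"
proof (rule ccontr)
  assume neg: "\<not> ?thesis"
  have "card A = (\<Sum>y\<in>f ` A. card {x\<in>A. f x = y})"
    using assms(1) by (rule sum.group[of A "f ` A" f "\<lambda>_. 1::nat", simplified, symmetric])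
  moreover have "A \<noteq> {}" using neg by auto
  moreover have "k * card {x\<in>A. f x = y} < card A" for y
  proof -
    have "\<not> card A \<le> k * card {x\<in>A. f x = y}"
      using neg by (metis (mono_tags, lifting) mem_Collect_eq subsetI)
    then show ?thesis by simp
  qed
  then have "(\<Sum>y\<in>f ` A. k * card {x\<in>A. f x = y}) < (\<Sum>y\<in>f ` A. card A)"
    using assms(1) \<open>A \<noteq> {}\<close> by (intro sum_strict_mono) auto
  ultimately have "k * card A < card (f ` A) * card A" by (simp flip: sum_distrib_left)
  then show False using assms(2) by auto
qed

context
  fixes R :: "'a::field set"
  assumes V: "valuation_ring R"
begin

lemma valuation_subring: "is_subring R" and valuation_dichotomy: "x \<noteq> 0 \<Longrightarrow> x \<in> R \<or> inverse x \<in> R"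
  using V unfolding valuation_ring_def by auto

lemma nonunit_add:
  assumes a: "a \<in> R" "\<And>w. w \<in> R \<Longrightarrow> a * w \<noteq> 1" and b: "b \<in> R" "\<And>w. w \<in> R \<Longrightarrow> b * w \<noteq> 1"
    and w: "w \<in> R"
  shows "(a + b) * w \<noteq> 1"
proof (cases "a = 0 \<or> b = 0")
  case True
  then show ?thesis using a(2)[OF w] b(2)[OF w] by auto
next
  case False
  then have "b / a \<in> R \<or> a / b \<in> R"
    using valuation_dichotomy[of "b / a"] by auto
  moreover have "(a + b) * w = a * ((1 + b / a) * w)" "(a + b) * w = b * ((1 + a / b) * w)"
    using False by (auto simp: field_simps)
  ultimately show ?thesis
    using a(2)[of "(1 + b / a) * w"] b(2)[of "(1 + a / b) * w"] w valuation_subring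
    by (metis subring_1 subring_add subring_mult)
qed

lemma nonunit_sum:
  assumes "\<And>i. i \<in> I \<Longrightarrow> f i \<in> R \<and> (\<forall>w\<in>R. f i * w \<noteq> 1)"
  shows "sum f I \<in> R \<and> (\<forall>w\<in>R. sum f I * w \<noteq> 1)"
  using assms
proof (induction I rule: infinite_finite_induct)
  case (insert i I)
  then have "f i + sum f I \<in> R" using subring_add[OF valuation_subring] by auto
  then show ?case using insert nonunit_add[of "f i" "sum f I"] by auto
qed (use subring_0[OF valuation_subring] in auto)

lemma exists_top:
  assumes "finite D" "D \<noteq> {}" "0 \<notin> D"
  shows "\<exists>d\<in>D. \<forall>e\<in>D. e / d \<in> R"
  using assms
proof (induction rule: finite_ne_induct)
  case (singleton x)
  then show ?case using subring_1[OF valuation_subring] by auto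
next
  case (insert x D)
  then obtain d where d: "d \<in> D" "\<And>e. e \<in> D \<Longrightarrow> e / d \<in> R" by auto
  have nz: "x \<noteq> 0" "d \<noteq> 0" using insert d by auto
  show ?case
  proof (cases "x / d \<in> R")
    case True
    then show ?thesis using d by auto
  next
    case False
    then have dx: "d / x \<in> R" using valuation_dichotomy[of "x / d"] nz by auto
    have "e / x \<in> R" if "e \<in> D" for e
      using subring_mult[OF valuation_subring d(2)[OF that] dx] nz by simp
    then show ?thesis using nz subring_1[OF valuation_subring] by auto
  qed
qed

lemma unit_if_power_unit:
  assumes "x ^ Suc n \<in> R" shows "x \<in> R"
proof (rule ccontr)
  assume "x \<notin> R"
  then have x0: "x \<noteq> 0" and i: "inverse x \<in> R"
    using subring_0[OF valuation_subring] valuation_dichotomy[of x] by auto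
  have "x ^ Suc n * inverse x ^ n \<in> R"
    using assms i subring_mult[OF valuation_subring] subring_power[OF valuation_subring] by blast
  moreover have "x ^ n * inverse x ^ n = 1" using x0 by (simp flip: power_mult_distrib)
  then have "x ^ Suc n * inverse x ^ n = x" by (simp add: mult.assoc)
  ultimately show False using \<open>x \<notin> R\<close> by metis
qed

end

text \<open>Representatives of different classes have pairwise different valuations. In a signed
  relation among them the largest one dominates: after division by it the other terms lie in the
  maximal ideal and cannot add up to a sign. So the representatives are dissociated and there are at
  most \<open>k\<close> classes.\<close>

lemma valuation_classes:
  fixes A :: "'a::field_char_0 set"
  assumes V: "valuation_ring R" and A: "finite A" "0 \<notin> A" "card (subset_sums A) \<le> 2 ^ k"
  shows "\<exists>B\<subseteq>A. card A \<le> k * card B \<and> (\<forall>x\<in>B. \<forall>y\<in>B. x / y \<in> R)"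
proof -
  have R: "is_subring R" by (rule valuation_subring[OF V])
  \<comment> \<open>The class of \<open>x\<close>: all elements of \<open>A\<close> that differ from
    \<open>x\<close> by a unit of \<open>R\<close>.\<close>
  define f where "f x = {y\<in>A. x / y \<in> R \<and> y / x \<in> R}" for x
  obtain D where D: "D \<subseteq> A" "inj_on f D" "f ` A = f ` D"
    using subset_image_inj[of "f ` A" f A] by auto
  have sep: "\<not> (x / y \<in> R \<and> y / x \<in> R)" if xy: "x \<in> D" "y \<in> D" "x \<noteq> y" for x y
  proof
    assume a: "x / y \<in> R \<and> y / x \<in> R"
    have nz: "x \<noteq> 0" "y \<noteq> 0" using xy D A by auto
    have "x / z \<in> R \<and> z / x \<in> R \<longleftrightarrow> y / z \<in> R \<and> z / y \<in> R" for z
      using a nz subring_mult[OF R, of "x / y" "y / z"] subring_mult[OF R, of "y / x" "x / z"]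
        subring_mult[OF R, of "z / x" "x / y"] subring_mult[OF R, of "z / y" "y / x"] by auto
    then have "f x = f y" unfolding f_def by auto
    then show False using D xy by (auto dest: inj_onD)
  qed
  have "card D \<le> k"
  proof (rule dissociated_card_le[OF A(1) D(1) A(3)])
    fix E :: "'a set" and \<epsilon> :: "'a \<Rightarrow> int"
    assume E: "E \<subseteq> D" "E \<noteq> {}" "\<And>d. d \<in> E \<Longrightarrow> \<epsilon> d \<in> {-1, 1}"
    have fE: "finite E" using E D A finite_subset by metis
    have E0: "0 \<notin> E" using E D A by auto
    obtain d where d: "d \<in> E" "\<And>e. e \<in> E \<Longrightarrow> e / d \<in> R" using exists_top[OF V fE E(2) E0] by auto
    let ?s = "\<Sum>e\<in>E - {d}. of_int (\<epsilon> e) * (e / d)"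
    have "\<forall>w\<in>R. ?s * w \<noteq> 1"
    proof (rule nonunit_sum[OF V, THEN conjunct2])
      fix e assume e: "e \<in> E - {d}"
      have "\<not> d / e \<in> R" using sep[of e d] e d E by auto
      moreover have "e / d * w = 1 \<Longrightarrow> w = d / e" for w using e d E0 by (auto simp: field_simps)
      ultimately have *: "e / d * w \<noteq> 1" if "w \<in> R" for w using that by auto
      have "of_int (\<epsilon> e) * (e / d) * w \<noteq> 1" if "w \<in> R" for w
        using *[of "of_int (\<epsilon> e) * w"] that subring_mult[OF R subring_of_int[OF R]] by (simp add: mult_ac)
      then show "of_int (\<epsilon> e) * (e / d) \<in> R \<and> (\<forall>w\<in>R. of_int (\<epsilon> e) * (e / d) * w \<noteq> 1)"
        using subring_mult[OF R subring_of_int[OF R] d(2)[of e], of "\<epsilon> e"] e by blast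
    qed
    \<comment> \<open>The relation amounts to \<open>?s\<close> being the sign opposite to
      \<open>\<epsilon> d\<close>; that sign would then be its own inverse, and so an inverse of
      \<open>?s\<close>.\<close>
    then have *: "?s * of_int (- \<epsilon> d) \<noteq> 1" using subring_of_int[OF R] by blast
    show "(\<Sum>d\<in>E. of_int (\<epsilon> d) * d) \<noteq> 0"
    proof
      assume "(\<Sum>d\<in>E. of_int (\<epsilon> d) * d) = 0"
      then have "(\<Sum>e\<in>E. of_int (\<epsilon> e) * e) / d = 0" by simp
      moreover have "d \<noteq> 0" using d(1) E0 by auto
      ultimately have "of_int (\<epsilon> d) + ?s = 0"
        by (subst (asm) sum.remove[OF fE d(1)]) (auto simp: add_divide_distrib sum_divide_distrib)
      then have "?s = - of_int (\<epsilon> d)" by (simp add: eq_neg_iff_add_eq_0 add.commute)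
      then show False using * E(3)[OF d(1)] by auto
    qed
  qed
  then have "card (f ` A) \<le> k" using D(3) card_image[OF D(2)] by simp
  then obtain B where B: "B \<subseteq> A" "card A \<le> k * card B" "\<And>x y. x \<in> B \<Longrightarrow> y \<in> B \<Longrightarrow> f x = f y"
    using popular_fibre[OF A(1)] by metis
  have "x / y \<in> R" if "x \<in> B" "y \<in> B" for x y
  proof -
    have "x \<in> f x" unfolding f_def using that B A subring_1[OF R] by auto
    then have "x \<in> f y" using B(3)[OF that] by simp
    then show ?thesis unfolding f_def by auto
  qed
  then show ?thesis using B by blast
qed

text \<open>Products of units are units, so a relation involving \<open>u\<close> puts both
  \<open>u powi n r\<close> and its inverse into \<open>R\<close>. One of the two is a positive
  power of \<open>u\<close> unless \<open>n r = 0\<close>, and a valuation ring containing a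
  positive power of \<open>u\<close> contains \<open>u\<close>.\<close>

lemma mult_indep_extend:
  fixes w :: "nat \<Rightarrow> 'a::field"
  assumes V: "valuation_ring R" and ind: "mult_indep r w"
    and w: "\<And>i. i < r \<Longrightarrow> w i \<in> R \<and> inverse (w i) \<in> R \<and> w i \<noteq> 0" and u: "u \<notin> R"
  shows "mult_indep (Suc r) (w(r := u))"
  unfolding mult_indep_def
proof (intro allI impI)
  have R: "is_subring R" by (rule valuation_subring[OF V])
  fix n :: "nat \<Rightarrow> int" and i
  assume eq: "(\<Prod>i<Suc r. (w(r := u)) i powi n i) = 1" and i: "i < Suc r"
  have wn: "w i powi m \<in> R" if "i < r" for i and m :: int
    using w[OF that] subring_power[OF R] by (cases m rule: int_cases2) (auto simp: power_int_minus simp flip: power_inverse)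
  have prodR: "(\<Prod>i<j. w i powi m i) \<in> R" if "j \<le> r" for m j
    using that by (induction j) (auto intro!: subring_1[OF R] subring_mult[OF R] wn)
  let ?P = "\<Prod>i<r. w i powi n i"
  have "?P * u powi n r = 1" using eq by simp
  moreover have "inverse ?P = (\<Prod>i<r. w i powi (- n i))"
    unfolding prod_inversef[symmetric] by (simp add: power_int_minus)
  then have "inverse ?P \<in> R" using prodR by simp
  ultimately have un: "u powi n r \<in> R" "u powi (- n r) \<in> R"
    using prodR[of r n] by (simp_all add: power_int_minus inverse_unique nonzero_imp_inverse_nonzero) (metis inverse_inverse_eq inverse_unique)+
  have nr: "n r = 0"
  proof (rule ccontr)
    assume "n r \<noteq> 0"
    then obtain m where "n r = int (Suc m) \<or> - n r = int (Suc m)"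
      by (metis int_cases2 minus_minus nat.exhaust of_nat_0 neg_equal_0_iff_equal)
    then have "u ^ Suc m \<in> R" using un by (metis power_int_of_nat)
    then show False using unit_if_power_unit[OF V] u by blast
  qed
  then have "?P = 1" using eq by simp
  then have "\<forall>i<r. n i = 0" using ind unfolding mult_indep_def by blast
  then show "n i = 0" using nr i less_Suc_eq by auto
qed

text \<open>A non-integral ratio is missing from some valuation ring. Within a popular class for
  that ring all ratios are units, so the missing ratio is independent of them and the rank bound
  drops by one. There are at most \<open>r\<close> rounds, each losing a factor
  \<open>k\<close>.\<close>

lemma integral_ratios_subset:
  fixes A :: "'a::field_char_0 set"
  assumes "finite A" "0 \<notin> A" "card (subset_sums A) \<le> 2 ^ k" "k \<ge> 1" "\<not> has_indep_ratios r A"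
  shows "\<exists>B\<subseteq>A. card A \<le> k ^ r * card B \<and> (\<forall>x\<in>B. \<forall>y\<in>B. algebraic_int (x / y))"
  using assms
proof (induction r arbitrary: A)
  case 0
  \<comment> \<open>The empty family is always independent, so the rank assumption is contradictory
    for \<open>r = 0\<close>.\<close>
  then show ?case by (auto simp: has_indep_ratios_def mult_indep_def)
next
  case (Suc r)
  show ?case
  proof (cases "\<forall>x\<in>A. \<forall>y\<in>A. algebraic_int (x / y)")
    case True
    then show ?thesis using Suc.prems by (intro exI[of _ A]) auto
  next
    case False
    then obtain x y where xy: "x \<in> A" "y \<in> A" "\<not> algebraic_int (x / y)" by auto
    obtain R where R: "valuation_ring R" "x / y \<notin> R" using exists_valuation_ring[OF xy(3)] by auto
    obtain B where B: "B \<subseteq> A" "card A \<le> k * card B" "\<And>x y. x \<in> B \<Longrightarrow> y \<in> B \<Longrightarrow> x / y \<in> R"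
      using valuation_classes[OF R(1) Suc.prems(1-3)] by metis
    have "\<not> has_indep_ratios r B"
    proof
      assume "has_indep_ratios r B"
      then obtain w where w: "\<And>i. i < r \<Longrightarrow> w i \<in> ratios B" "mult_indep r w"
        unfolding has_indep_ratios_def by auto
      have "w i \<in> R \<and> inverse (w i) \<in> R \<and> w i \<noteq> 0" if i: "i < r" for i
      proof -
        obtain a b where "a \<in> B" "b \<in> B" "w i = a / b" using w(1)[OF i] unfolding ratios_def by auto
        moreover have "a \<noteq> 0" "b \<noteq> 0" using calculation B Suc.prems by auto
        ultimately show ?thesis using B(3) by auto
      qed
      then have "mult_indep (Suc r) (w(r := x / y))" using mult_indep_extend[OF R(1) w(2) _ R(2)] by blast
      moreover have "(w(r := x / y)) i \<in> ratios A" if "i < Suc r" for i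
        using w(1)[of i] that xy B(1) unfolding ratios_def by (auto simp: less_Suc_eq)
      ultimately show False using Suc.prems(5) unfolding has_indep_ratios_def by blast
    qed
    moreover have "finite B" "0 \<notin> B" using B Suc.prems finite_subset by auto
    moreover have "card (subset_sums B) \<le> 2 ^ k"
      using card_mono[OF finite_subset_sums[OF Suc.prems(1)] subset_sums_mono[OF B(1)]] Suc.prems(3) by simp
    ultimately obtain C where C: "C \<subseteq> B" "card B \<le> k ^ r * card C" "\<forall>x\<in>C. \<forall>y\<in>C. algebraic_int (x / y)"
      using Suc.IH[of B] Suc.prems(4) by auto
    have "card A \<le> k * (k ^ r * card C)" using B(2) C(2) by (meson le_trans mult_le_mono2)
    then show ?thesis using C B by (intro exI[of _ C]) auto
  qed
qed

section \<open>Embeddings of the algebraic integers into the complex numbers\<close>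

text \<open>A ring homomorphism carried by a total function; only its values on the subring
  \<open>R\<close> are constrained. Differences together with products make additive inverses and
  zero automatic.\<close>

definition hom_on :: "'a::field set \<Rightarrow> ('a \<Rightarrow> complex) \<Rightarrow> bool" where
  "hom_on R \<phi> \<longleftrightarrow> \<phi> 1 = 1 \<and> (\<forall>x\<in>R. \<forall>y\<in>R. \<phi> (x - y) = \<phi> x - \<phi> y \<and> \<phi> (x * y) = \<phi> x * \<phi> y)"

context
  fixes R :: "'a::field set" and \<phi> :: "'a \<Rightarrow> complex"
  assumes R: "is_subring R" and \<phi>: "hom_on R \<phi>"
begin

lemma hom_1: "\<phi> 1 = 1"
  and hom_diff: "x \<in> R \<Longrightarrow> y \<in> R \<Longrightarrow> \<phi> (x - y) = \<phi> x - \<phi> y"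
  and hom_mult: "x \<in> R \<Longrightarrow> y \<in> R \<Longrightarrow> \<phi> (x * y) = \<phi> x * \<phi> y"
  using \<phi> unfolding hom_on_def by auto

lemma hom_0: "\<phi> 0 = 0"
  using hom_diff[OF subring_1[OF R] subring_1[OF R]] by simp

lemma hom_add: "x \<in> R \<Longrightarrow> y \<in> R \<Longrightarrow> \<phi> (x + y) = \<phi> x + \<phi> y"
  using hom_diff[of x "- y"] hom_diff[OF subring_0[OF R], of y] subring_minus[OF R, of y] hom_0 by simp

lemma hom_power: "x \<in> R \<Longrightarrow> \<phi> (x ^ n) = \<phi> x ^ n"
  by (induction n) (auto simp: hom_1 hom_mult subring_power[OF R])

lemma hom_sum: "(\<And>i. i \<in> I \<Longrightarrow> f i \<in> R) \<Longrightarrow> \<phi> (sum f I) = (\<Sum>i\<in>I. \<phi> (f i))"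
  by (induction I rule: infinite_finite_induct) (auto simp: hom_0 hom_add subring_sum[OF R])

lemma hom_of_nat: "\<phi> (of_nat n) = of_nat n"
  by (induction n) (auto simp: hom_0 hom_1 hom_add subring_1[OF R] subring_of_nat[OF R])

lemma hom_of_int: "\<phi> (of_int n) = of_int n"
  using hom_diff[OF subring_0[OF R] subring_of_nat[OF R]]
  by (cases n rule: int_cases2) (auto simp: hom_of_nat hom_0)

lemma coeff_map_hom: "coeff (map_poly \<phi> p) i = \<phi> (coeff p i)"
  by (simp add: coeff_map_poly hom_0)

lemma map_hom_diff:
  "\<forall>i. coeff p i \<in> R \<Longrightarrow> \<forall>i. coeff q i \<in> R \<Longrightarrow> map_poly \<phi> (p - q) = map_poly \<phi> p - map_poly \<phi> q"
  by (rule poly_eqI) (simp add: coeff_map_hom hom_diff)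

lemma map_hom_mult:
  "\<forall>i. coeff p i \<in> R \<Longrightarrow> \<forall>i. coeff q i \<in> R \<Longrightarrow> map_poly \<phi> (p * q) = map_poly \<phi> p * map_poly \<phi> q"
  by (rule poly_eqI) (simp add: coeff_map_hom coeff_mult hom_sum hom_mult subring_mult[OF R])

lemma map_hom_monom: "map_poly \<phi> (monom a n) = monom (\<phi> a) n"
  by (rule poly_eqI) (auto simp: coeff_map_hom hom_0)

lemma map_hom_pCons: "map_poly \<phi> (pCons a p) = pCons (\<phi> a) (map_poly \<phi> p)"
  by (rule poly_eqI) (auto simp: coeff_map_hom coeff_pCons split: nat.splits)

lemma hom_poly: "\<forall>i. coeff p i \<in> R \<Longrightarrow> x \<in> R \<Longrightarrow> \<phi> (poly p x) = poly (map_poly \<phi> p) (\<phi> x)"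
proof (induction p)
  case 0
  then show ?case by (simp add: hom_0)
next
  case (pCons a p)
  have a: "a \<in> R" "\<forall>i. coeff p i \<in> R"
    using pCons.prems(1) by (metis coeff_pCons_0, metis coeff_pCons_Suc)
  then have "poly p x \<in> R" using subring_poly[OF R] pCons.prems by blast
  then show ?case
    using pCons a by (simp add: map_hom_pCons hom_add hom_mult subring_mult[OF R])
qed

lemma map_hom_of_int: "map_poly \<phi> (map_poly of_int p) = map_poly of_int p"
  by (rule poly_eqI) (simp add: coeff_map_hom coeff_map_poly hom_of_int)

lemma hom_ipoly: "x \<in> R \<Longrightarrow> \<phi> (poly (map_poly of_int p) x) = poly (map_poly of_int p) (\<phi> x)"
  by (subst hom_poly) (auto simp: coeff_map_poly subring_of_int[OF R] map_hom_of_int)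

end

text \<open>A nonzero algebraic integer is a root of an integer polynomial with nonzero constant
  term. The homomorphism preserves this equation, and an image 0 would force the constant term to
  vanish.\<close>

lemma hom_eq_0_iff:
  fixes R :: "'a::field_char_0 set"
  assumes R: "is_subring R" and \<phi>: "hom_on R \<phi>" and x: "x \<in> R" "algebraic_int x"
  shows "\<phi> x = 0 \<longleftrightarrow> x = 0"
proof
  assume 0: "\<phi> x = 0"
  show "x = 0"
  proof (rule ccontr)
    assume "x \<noteq> 0"
    then obtain p where p: "coeff p 0 \<noteq> 0" "poly (map_poly of_int p) x = 0"
      using algebraicE'_nonzero[of x] x(2) by blast
    have "poly (map_poly of_int p) (\<phi> x) = 0"
      using hom_ipoly[OF R \<phi> x(1), of p] p hom_0[OF R \<phi>] by simp
    then show False using p(1) unfolding 0 poly_0_coeff_0 by (simp add: coeff_map_poly)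
  qed
qed (use hom_0[OF R \<phi>] in auto)

text \<open>Since \<open>R\<close> is only a ring, division by \<open>f\<close> is replaced by
  cross-multiplication with leading coefficients, which lowers the degree of \<open>g\<close>.
  Injectivity of \<open>\<phi>\<close> then cancels the factor
  \<open>\<phi> (lead_coeff f)\<close>.\<close>

lemma root_of_minimal_imp_root:
  fixes R :: "'a::field set"
  assumes R: "is_subring R" and \<phi>: "hom_on R \<phi>" and inj: "\<And>a. a \<in> R \<Longrightarrow> \<phi> a = 0 \<Longrightarrow> a = 0"
    and f: "\<forall>i. coeff f i \<in> R" "f \<noteq> 0" "poly f x = 0"
    and min: "\<And>g. \<forall>i. coeff g i \<in> R \<Longrightarrow> g \<noteq> 0 \<Longrightarrow> poly g x = 0 \<Longrightarrow> degree f \<le> degree g"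
    and b: "poly (map_poly \<phi> f) b = 0"
  shows "\<forall>i. coeff g i \<in> R \<Longrightarrow> poly g x = 0 \<Longrightarrow> poly (map_poly \<phi> g) b = 0"
proof (induction "degree g" arbitrary: g rule: less_induct)
  case less
  show ?case
  proof (cases "g = 0")
    case False
    have fg: "degree f \<le> degree g" using min less.prems False by blast
    let ?cf = "lead_coeff f" and ?cg = "lead_coeff g" and ?d = "degree g - degree f"
    define h where "h = monom ?cf 0 * g - monom ?cg ?d * f"
    have m: "\<forall>i. coeff (monom ?cf 0) i \<in> R" "\<forall>i. coeff (monom ?cg ?d) i \<in> R"
      using coeffs_monom[OF R] f(1) less.prems(1) by blast+
    have h: "\<forall>i. coeff h i \<in> R"
      unfolding h_def by (intro coeffs_minus[OF R] coeffs_mult[OF R] m f(1) less.prems(1))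
    have hx: "poly h x = 0" unfolding h_def using f less.prems by simp
    have "poly (map_poly \<phi> h) b = 0"
    proof (cases "degree g = 0")
      case True
      then obtain c where "g = [:c:]" by (rule degree_eq_zeroE)
      then show ?thesis using less.prems False by simp
    next
      case False
      have "degree h < degree g"
      proof -
        have "degree h \<le> degree g - 1"
        proof (rule degree_le, intro allI impI)
          fix i assume i: "i > degree g - 1"
          show "coeff h i = 0"
          proof (cases "i = degree g")
            case True
            then show ?thesis unfolding h_def using fg by (simp add: monom_0 coeff_monom_mult)
          next
            case False
            then have "i > degree g" "i - ?d > degree f" "i \<ge> ?d" using i fg by auto
            then show ?thesis unfolding h_def by (simp add: monom_0 coeff_monom_mult coeff_eq_0)
          qed
        qed
        then show ?thesis using False by simp
      qed
      then show ?thesis using less.hyps h hx by blast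
    qed
    moreover have "map_poly \<phi> h = monom (\<phi> ?cf) 0 * map_poly \<phi> g - monom (\<phi> ?cg) ?d * map_poly \<phi> f"
      unfolding h_def using m f(1) less.prems(1)
      by (simp add: map_hom_diff[OF R \<phi>] map_hom_mult[OF R \<phi>] map_hom_monom[OF R \<phi>] coeffs_mult[OF R] del: coeff_monom)
    ultimately have "\<phi> ?cf * poly (map_poly \<phi> g) b = 0" using b by (simp add: poly_monom)
    then show ?thesis using inj[of ?cf] f by auto
  qed simp
qed

text \<open>\<open>\<psi>\<close> evaluates an arbitrarily chosen representing polynomial at
  \<open>b\<close>. Two representations of one element differ by a polynomial vanishing at
  \<open>x\<close>, whose image vanishes at \<open>b\<close> by minimality of \<open>f\<close>, so
  the choice is immaterial.\<close>

lemma extend_hom_to_root: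
  fixes R :: "'a::field set"
  assumes R: "is_subring R" and \<phi>: "hom_on R \<phi>" and inj: "\<And>a. a \<in> R \<Longrightarrow> \<phi> a = 0 \<Longrightarrow> a = 0"
    and f: "\<forall>i. coeff f i \<in> R" "f \<noteq> 0" "poly f x = 0"
    and min: "\<And>g. \<forall>i. coeff g i \<in> R \<Longrightarrow> g \<noteq> 0 \<Longrightarrow> poly g x = 0 \<Longrightarrow> degree f \<le> degree g"
    and b: "poly (map_poly \<phi> f) b = 0"
  shows "\<exists>\<psi>. hom_on (adjoin R x) \<psi> \<and> \<psi> x = b \<and> (\<forall>a\<in>R. \<psi> a = \<phi> a)"
proof -
  define \<psi> where "\<psi> a = poly (map_poly \<phi> (SOME g. (\<forall>i. coeff g i \<in> R) \<and> poly g x = a)) b" for a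
  have \<psi>: "\<psi> (poly g x) = poly (map_poly \<phi> g) b" if g: "\<forall>i. coeff g i \<in> R" for g
  proof -
    define h where "h = (SOME h. (\<forall>i. coeff h i \<in> R) \<and> poly h x = poly g x)"
    have h: "(\<forall>i. coeff h i \<in> R) \<and> poly h x = poly g x"
      unfolding h_def by (rule someI[of _ g]) (use g in auto)
    have hg: "\<forall>i. coeff (h - g) i \<in> R" using h g by (intro coeffs_minus[OF R]) auto
    have "poly (map_poly \<phi> (h - g)) b = 0"
      by (rule root_of_minimal_imp_root[OF R \<phi> inj f min b]) (use hg h in auto)
    then show ?thesis using h g unfolding \<psi>_def h_def[symmetric] by (simp add: map_hom_diff[OF R \<phi>])
  qed
  have "hom_on (adjoin R x) \<psi>"
    unfolding hom_on_def
  proof (intro conjI ballI)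
    show "\<psi> 1 = 1"
      using \<psi>[of "[:1:]"] subring_1[OF R] subring_0[OF R] hom_1[OF R \<phi>]
      by (simp add: coeff_pCons map_hom_pCons[OF R \<phi>] split: nat.splits)
  next
    fix u v assume "u \<in> adjoin R x" "v \<in> adjoin R x"
    then obtain p q where "u = poly p x" "v = poly q x" "\<forall>i. coeff p i \<in> R" "\<forall>i. coeff q i \<in> R"
      unfolding adjoin_def by auto
    note pq = this
    show "\<psi> (u - v) = \<psi> u - \<psi> v"
      using \<psi>[of p] \<psi>[of q] \<psi>[of "p - q"] pq coeffs_minus[OF R, of p q] by (simp add: map_hom_diff[OF R \<phi>])
    show "\<psi> (u * v) = \<psi> u * \<psi> v"
      using \<psi>[of p] \<psi>[of q] \<psi>[of "p * q"] pq coeffs_mult[OF R, of p q] by (simp add: map_hom_mult[OF R \<phi>])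
  qed
  moreover have "\<psi> x = b"
    using \<psi>[of "[:0, 1:]"] subring_1[OF R] subring_0[OF R] hom_1[OF R \<phi>] hom_0[OF R \<phi>]
    by (simp add: coeff_pCons map_hom_pCons[OF R \<phi>] split: nat.splits)
  moreover have "\<psi> a = \<phi> a" if "a \<in> R" for a
    using \<psi>[of "[:a:]"] that subring_0[OF R]
    by (simp add: coeff_pCons map_hom_pCons[OF R \<phi>] split: nat.splits)
  ultimately show ?thesis by blast
qed

lemma adjoin_algebraic_int:
  fixes R :: "'a::field_char_0 set"
  assumes "R \<subseteq> {x. algebraic_int x}" "algebraic_int x"
  shows "adjoin R x \<subseteq> {x. algebraic_int x}"
proof
  fix a assume "a \<in> adjoin R x"
  then obtain p where "\<forall>i. coeff p i \<in> R" "a = poly p x" unfolding adjoin_def by auto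
  then show "a \<in> {x. algebraic_int x}"
    using subring_poly[OF is_subring_algebraic_int, of p x] assms by auto
qed

lemma extend_hom:
  fixes R :: "'a::field_char_0 set"
  assumes R: "is_subring R" "R \<subseteq> {x. algebraic_int x}" and \<phi>: "hom_on R \<phi>" and x: "algebraic_int x"
  shows "\<exists>\<psi>. hom_on (adjoin R x) \<psi> \<and> (\<forall>a\<in>R. \<psi> a = \<phi> a)"
proof -
  have inj: "\<phi> a = 0 \<Longrightarrow> a = 0" if "a \<in> R" for a using hom_eq_0_iff[OF R(1) \<phi> that] that R by auto
  let ?P = "\<lambda>f. (\<forall>i. coeff f i \<in> R) \<and> f \<noteq> 0 \<and> poly f x = 0"
  obtain p where p: "lead_coeff p = 1" "\<forall>i. coeff p i \<in> \<int>" "poly p x = 0"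
    using x by (auto elim: algebraic_int.cases)
  have "coeff p i \<in> R" for i
    using p(2)[rule_format, of i] subring_of_int[OF R(1)] by (auto elim!: Ints_cases)
  then have "?P p" using p by auto
  then obtain f where f: "?P f" and min: "\<And>g. ?P g \<Longrightarrow> degree f \<le> degree g"
    using ex_has_least_nat[of ?P p degree] by blast
  have "degree f \<noteq> 0"
  proof
    assume "degree f = 0"
    then obtain c where "f = [:c:]" by (rule degree_eq_zeroE)
    then show False using f by simp
  qed
  moreover have "degree f \<le> degree (map_poly \<phi> f)"
    by (rule le_degree) (use inj[of "lead_coeff f"] f in \<open>auto simp: coeff_map_hom[OF R(1) \<phi>]\<close>)
  ultimately obtain b where "poly (map_poly \<phi> f) b = 0"
    using alg_closed_imp_poly_has_root[of "map_poly \<phi> f"] by auto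
  then show ?thesis
    using extend_hom_to_root[OF R(1) \<phi> inj, of f x b] f min by blast
qed

definition emb :: "('a::field_char_0 \<Rightarrow> complex) \<Rightarrow> bool" where
  "emb \<sigma> \<longleftrightarrow> hom_on {x. algebraic_int x} \<sigma>"

text \<open>Partial homomorphisms are encoded by their graphs, which turns extension into inclusion
  and makes Zorn's lemma applicable. A maximal one is defined on all algebraic integers, because a
  further one could be adjoined otherwise.\<close>

lemma extend_to_emb:
  fixes R0 :: "'a::field_char_0 set"
  assumes R0: "is_subring R0" "R0 \<subseteq> {x. algebraic_int x}" and \<phi>0: "hom_on R0 \<phi>0"
  shows "\<exists>\<sigma>. emb \<sigma> \<and> (\<forall>a\<in>R0. \<sigma> a = \<phi>0 a)"
proof -
  define gr :: "'a set \<Rightarrow> ('a \<Rightarrow> complex) \<Rightarrow> ('a \<times> complex) set" where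
    "gr R \<phi> = (\<lambda>a. (a, \<phi> a)) ` R" for R \<phi>
  define ok where "ok R \<phi> \<longleftrightarrow> is_subring R \<and> R \<subseteq> {x. algebraic_int x} \<and> hom_on R \<phi> \<and> gr R0 \<phi>0 \<subseteq> gr R \<phi>" for R \<phi>
  define \<G> where "\<G> = {gr R \<phi> | R \<phi>. ok R \<phi>}"
  have "\<exists>M\<in>\<G>. \<forall>X\<in>\<G>. M \<subseteq> X \<longrightarrow> X = M"
  proof (rule subset_Zorn_nonempty)
    have "ok R0 \<phi>0" unfolding ok_def using assms by auto
    then show "\<G> \<noteq> {}" unfolding \<G>_def by auto
  next
    fix C assume C: "C \<noteq> {}" "subset.chain \<G> C"
    have ch: "\<And>G G'. G \<in> C \<Longrightarrow> G' \<in> C \<Longrightarrow> G \<subseteq> G' \<or> G' \<subseteq> G" "C \<subseteq> \<G>"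
      using C unfolding subset_chain_def by auto
    define R where "R = fst ` (\<Union>C)"
    \<comment> \<open>Any two graphs in the chain are nested, so at each point of \<open>R\<close>
      there is only one value to choose.\<close>
    define \<phi> where "\<phi> a = (SOME z. (a, z) \<in> \<Union>C)" for a
    have val: "\<psi> a = \<phi> a" if "gr S \<psi> \<in> C" "a \<in> S" for S \<psi> a
    proof -
      have "(a, \<psi> a) \<in> gr S \<psi>" unfolding gr_def using that by auto
      then have "(a, \<phi> a) \<in> \<Union>C" unfolding \<phi>_def using that(1) by (metis UnionI someI)
      then obtain G where G: "G \<in> C" "(a, \<phi> a) \<in> G" by auto
      then have "gr S \<psi> \<subseteq> G \<or> G \<subseteq> gr S \<psi>" using ch that by auto
      moreover obtain S' \<psi>' where "G = gr S' \<psi>'" using G ch unfolding \<G>_def by blast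
      ultimately show ?thesis using G that unfolding gr_def by auto
    qed
    have two: "\<exists>S \<psi>. ok S \<psi> \<and> gr S \<psi> \<in> C \<and> a \<in> S \<and> b \<in> S" if ab: "a \<in> R" "b \<in> R" for a b
    proof -
      obtain z z' G G' where G: "(a, z) \<in> G" "G \<in> C" "(b, z') \<in> G'" "G' \<in> C" using ab unfolding R_def by auto
      then obtain H where H: "H \<in> C" "(a, z) \<in> H" "(b, z') \<in> H" using ch(1)[of G G'] by blast
      then obtain S \<psi> where "H = gr S \<psi>" "ok S \<psi>" using ch unfolding \<G>_def by blast
      then show ?thesis using H unfolding gr_def by auto
    qed
    have sub: "S \<subseteq> R" if "gr S \<psi> \<in> C" for S \<psi>
      unfolding R_def using that by (force simp: gr_def)
    obtain G0 where G0: "G0 \<in> C" using C by auto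
    then obtain S0 \<psi>0 where S0: "G0 = gr S0 \<psi>0" "ok S0 \<psi>0" using ch unfolding \<G>_def by blast
    have "1 \<in> S0" using S0 subring_1 unfolding ok_def by blast
    have subR: "is_subring R"
      unfolding is_subring_def
    proof (intro conjI ballI)
      show "1 \<in> R" using \<open>1 \<in> S0\<close> sub[of S0 \<psi>0] G0 S0 by auto
      fix a b assume ab: "a \<in> R" "b \<in> R"
      have "\<exists>S \<psi>. ok S \<psi> \<and> gr S \<psi> \<in> C \<and> a \<in> S \<and> b \<in> S" by (rule two[OF ab])
      then obtain S \<psi> where S: "ok S \<psi> \<and> gr S \<psi> \<in> C \<and> a \<in> S \<and> b \<in> S" by (elim exE)
      then have "is_subring S" "S \<subseteq> R" using sub[of S \<psi>] unfolding ok_def by auto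
      then have "a - b \<in> S" "a * b \<in> S" using S subring_diff[of S a b] subring_mult[of S a b] by auto
      then show "a - b \<in> R" "a * b \<in> R" using \<open>S \<subseteq> R\<close> by auto
    qed
    have "hom_on R \<phi>"
      unfolding hom_on_def
    proof (intro conjI ballI)
      show "\<phi> 1 = 1"
        using val[of S0 \<psi>0 1] \<open>1 \<in> S0\<close> G0 S0 hom_1[of S0 \<psi>0] unfolding ok_def by auto
      fix a b assume ab: "a \<in> R" "b \<in> R"
      have "\<exists>S \<psi>. ok S \<psi> \<and> gr S \<psi> \<in> C \<and> a \<in> S \<and> b \<in> S" by (rule two[OF ab])
      then obtain S \<psi> where S: "ok S \<psi> \<and> gr S \<psi> \<in> C \<and> a \<in> S \<and> b \<in> S" by (elim exE)
      then have ring: "is_subring S" "hom_on S \<psi>" unfolding ok_def by auto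
      then have "a - b \<in> S" "a * b \<in> S" using S subring_diff[of S a b] subring_mult[of S a b] by auto
      then have "\<phi> (a - b) = \<psi> (a - b)" "\<phi> (a * b) = \<psi> (a * b)" "\<phi> a = \<psi> a" "\<phi> b = \<psi> b"
        using val[of S \<psi>] S by auto
      then show "\<phi> (a - b) = \<phi> a - \<phi> b" "\<phi> (a * b) = \<phi> a * \<phi> b"
        using S hom_diff[OF ring, of a b] hom_mult[OF ring, of a b] by simp_all
    qed
    moreover have "R \<subseteq> {x. algebraic_int x}"
    proof
      fix a assume a: "a \<in> R"
      have "\<exists>S \<psi>. ok S \<psi> \<and> gr S \<psi> \<in> C \<and> a \<in> S \<and> a \<in> S" by (rule two[OF a a])
      then obtain S \<psi> where "ok S \<psi> \<and> gr S \<psi> \<in> C \<and> a \<in> S \<and> a \<in> S" by (elim exE)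
      then show "a \<in> {x. algebraic_int x}" unfolding ok_def by auto
    qed
    moreover have gr: "gr R \<phi> = \<Union>C"
    proof
      show "gr R \<phi> \<subseteq> \<Union>C"
      proof
        fix t assume "t \<in> gr R \<phi>"
        then obtain a where a: "a \<in> R" "t = (a, \<phi> a)" unfolding gr_def by auto
        have "\<exists>S \<psi>. ok S \<psi> \<and> gr S \<psi> \<in> C \<and> a \<in> S \<and> a \<in> S" by (rule two[OF a(1) a(1)])
        then obtain S \<psi> where S: "ok S \<psi> \<and> gr S \<psi> \<in> C \<and> a \<in> S \<and> a \<in> S" by (elim exE)
        then have "t \<in> gr S \<psi>" using val[of S \<psi> a] a(2) by (auto simp: gr_def)
        then show "t \<in> \<Union>C" using S by auto
      qed
      show "\<Union>C \<subseteq> gr R \<phi>"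
      proof
        fix t assume "t \<in> \<Union>C"
        then obtain G where G: "G \<in> C" "t \<in> G" by auto
        then obtain S \<psi> where S: "G = gr S \<psi>" using ch unfolding \<G>_def by blast
        then obtain a where a: "a \<in> S" "t = (a, \<psi> a)" using G unfolding gr_def by auto
        then show "t \<in> gr R \<phi>" using val[of S \<psi> a] sub[of S \<psi>] G S unfolding gr_def by auto
      qed
    qed
    moreover have "gr R0 \<phi>0 \<subseteq> \<Union>C" using G0 S0 unfolding ok_def by blast
    ultimately have "ok R \<phi>" using subR unfolding ok_def by simp
    then show "\<Union>C \<in> \<G>" unfolding \<G>_def gr[symmetric] by blast
  qed
  then obtain M where M: "M \<in> \<G>" and max: "\<And>X. X \<in> \<G> \<Longrightarrow> M \<subseteq> X \<Longrightarrow> X = M" by blast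
  then obtain R \<phi> where R\<phi>: "M = gr R \<phi>" "ok R \<phi>" unfolding \<G>_def by blast
  then have R: "is_subring R" "R \<subseteq> {x. algebraic_int x}" and \<phi>: "hom_on R \<phi>" and ext: "gr R0 \<phi>0 \<subseteq> gr R \<phi>"
    unfolding ok_def by auto
  have "{x. algebraic_int x} \<subseteq> R"
  proof
    fix x :: 'a assume "x \<in> {x. algebraic_int x}"
    then have x: "algebraic_int x" by simp
    obtain \<psi> where \<psi>: "hom_on (adjoin R x) \<psi>" "\<forall>a\<in>R. \<psi> a = \<phi> a"
      using extend_hom[OF R \<phi> x] by blast
    have le: "gr R \<phi> \<subseteq> gr (adjoin R x) \<psi>"
      using \<psi>(2) subset_adjoin[OF R(1), of x] unfolding gr_def by force
    have "ok (adjoin R x) \<psi>"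
      unfolding ok_def using is_subring_adjoin[OF R(1)] adjoin_algebraic_int[OF R(2) x] \<psi> le ext by auto
    then have "gr (adjoin R x) \<psi> = M" using max[of "gr (adjoin R x) \<psi>"] le R\<phi> unfolding \<G>_def by blast
    then have "gr (adjoin R x) \<psi> = gr R \<phi>" using R\<phi> by simp
    moreover have "(x, \<psi> x) \<in> gr (adjoin R x) \<psi>" using in_adjoin[OF R(1)] unfolding gr_def by blast
    ultimately show "x \<in> R" unfolding gr_def by auto
  qed
  then have "R = {x. algebraic_int x}" using R by auto
  then have "emb \<phi>" unfolding emb_def using \<phi> by simp
  moreover have "\<phi> a = \<phi>0 a" if "a \<in> R0" for a
    using ext that unfolding gr_def by auto
  ultimately show ?thesis by blast
qed

section \<open>Integer minimal polynomials and conjugates outside the open unit disc\<close>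

lemma map_of_int_mult:
  "map_poly of_int (p * q) = (map_poly of_int p * map_poly of_int q :: 'a::comm_ring_1 poly)"
  by (rule poly_eqI) (simp add: coeff_map_poly coeff_mult)

lemma map_of_int_smult: "map_poly of_int (smult c p) = (smult (of_int c) (map_poly of_int p) :: 'a::comm_ring_1 poly)"
  by (rule poly_eqI) (simp add: coeff_map_poly)

lemma map_of_int_add: "map_poly of_int (p + q) = (map_poly of_int p + map_poly of_int q :: 'a::comm_ring_1 poly)"
  by (rule poly_eqI) (simp add: coeff_map_poly)

lemma degree_map_of_int: "degree (map_poly of_int p :: 'a::field_char_0 poly) = degree p"
  by (rule degree_map_poly) auto

lemma norm_prod_roots_less_1:
  fixes A :: "complex multiset"
  shows "(\<And>x. x \<in># A \<Longrightarrow> cmod x < 1) \<Longrightarrow> A = {#} \<or> cmod (poly (\<Prod>x\<in>#A. [:-x, 1:]) 0) < 1"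
proof (induction A)
  case (add x A)
  then have "cmod (poly (\<Prod>x\<in>#A. [:-x, 1:]) 0) \<le> 1" by fastforce
  then have "cmod x * cmod (poly (\<Prod>x\<in>#A. [:-x, 1:]) 0) \<le> cmod x * 1"
    by (intro mult_left_mono) auto
  also have "\<dots> < 1" using add.prems[of x] by simp
  finally show ?case by (simp add: norm_mult)
qed simp

text \<open>The product of the roots is, up to sign, the constant coefficient, a nonzero integer;
  not all roots can be smaller than 1.\<close>

lemma exists_root_norm_ge_1:
  fixes f :: "int poly"
  assumes "lead_coeff f = 1" "coeff f 0 \<noteq> 0" "degree f \<noteq> 0"
  shows "\<exists>b::complex. poly (map_poly of_int f) b = 0 \<and> cmod b \<ge> 1"
proof (rule ccontr)
  assume neg: "\<not> ?thesis"
  let ?F = "map_poly of_int f :: complex poly"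
  have dF: "degree ?F = degree f" by (rule degree_map_of_int)
  have lc: "lead_coeff ?F = 1" unfolding dF using assms by (simp add: coeff_map_poly)
  then have "?F \<noteq> 0" by auto
  then obtain A where A: "size A = degree ?F" "?F = (\<Prod>x\<in>#A. [:-x, 1:])"
    using alg_closed_imp_factorization[of ?F] lc by auto
  have "poly ?F x = 0" if "x \<in># A" for x
    using that unfolding A(2) poly_prod_mset by (auto simp: prod_mset_zero_iff)
  then have "A = {#} \<or> cmod (poly ?F 0) < 1"
    using norm_prod_roots_less_1[of A] neg A(2) by force
  moreover have "cmod (poly ?F 0) \<ge> 1"
    using assms(2) by (simp add: poly_0_coeff_0 coeff_map_poly)
  ultimately show False using A(1) dF assms(3) by auto
qed

text \<open>A consequence of unique factorisation over the integers: a monic polynomial of least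
  degree among the monic ones killing \<open>\<beta>\<close> is irreducible, hence prime. If
  \<open>h\<close> has least degree among all nonzero ones, pseudo-division gives
  \<open>smult a f = h * q\<close>, so \<open>f\<close> divides \<open>h\<close> or
  \<open>q\<close>; the latter is excluded by degree. Thus \<open>f\<close> is minimal also among
  non-monic polynomials, which extending homomorphisms requires.\<close>

lemma monic_int_minimal_poly:
  fixes \<beta> :: "'a::field_char_0"
  assumes \<beta>: "algebraic_int \<beta>" "\<beta> \<noteq> 0"
  shows "\<exists>f::int poly. lead_coeff f = 1 \<and> coeff f 0 \<noteq> 0 \<and> degree f \<noteq> 0 \<and> poly (map_poly of_int f) \<beta> = 0 \<and>
    (\<forall>g. g \<noteq> 0 \<longrightarrow> poly (map_poly of_int g) \<beta> = 0 \<longrightarrow> degree f \<le> degree g)"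
proof -
  let ?ip = "\<lambda>p::int poly. poly (map_poly of_int p) \<beta>"
  let ?P = "\<lambda>f. lead_coeff f = 1 \<and> ?ip f = 0"
  obtain p where "?P p" using \<beta>(1) unfolding algebraic_int_altdef_ipoly by blast
  then obtain f where f: "lead_coeff f = 1" "?ip f = 0" and min: "\<And>g. ?P g \<Longrightarrow> degree f \<le> degree g"
    using ex_has_least_nat[of ?P p degree] by blast
  have f0: "f \<noteq> 0" using f by auto
  have nonconst: "degree g \<noteq> 0" if "g \<noteq> 0" "?ip g = 0" for g
  proof
    assume "degree g = 0"
    then obtain c where "g = [:c:]" by (rule degree_eq_zeroE)
    then show False using that by (simp add: map_poly_pCons)
  qed
  have c0: "coeff f 0 \<noteq> 0"
  proof
    assume "coeff f 0 = 0"
    then obtain g where g: "f = pCons 0 g" by (metis coeff_pCons_0 pCons_cases)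
    then have "g \<noteq> 0" using f0 by auto
    then have "?P g" "degree g < degree f" using f \<beta>(2) g by (auto simp: map_poly_pCons)
    then show False using min by force
  qed
  have "irreducible f"
  proof (rule irreducibleI)
    show "f \<noteq> 0" by (rule f0)
    show "\<not> f dvd 1" using nonconst[OF f0 f(2)] dvd_imp_degree_le[of f 1] by auto
  next
    fix a b assume ab: "f = a * b"
    have "lead_coeff a * lead_coeff b = 1" using f(1) unfolding ab lead_coeff_mult .
    then have lc: "lead_coeff a = lead_coeff b" "lead_coeff a * lead_coeff a = 1"
      "lead_coeff b * lead_coeff b = 1" using zmult_eq_1_iff by auto
    have nz: "a \<noteq> 0" "b \<noteq> 0" using f0 ab by auto
    then have deg: "degree f = degree a + degree b" using ab degree_mult_eq by blast
    have unit: "b dvd 1" if "lead_coeff b * lead_coeff b = 1" "degree b = 0" for b :: "int poly"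
    proof -
      obtain c where "b = [:c:]" using \<open>degree b = 0\<close> by (rule degree_eq_zeroE)
      then have "b * b = 1" using that by (simp add: one_pCons)
      then show ?thesis by (metis dvd_triv_left)
    qed
    have le: "degree f \<le> degree a" if "?ip a = 0" "lead_coeff a * lead_coeff a = 1" for a
      using min[of "smult (lead_coeff a) a"] that by (cases "a = 0") (auto simp: map_of_int_smult)
    have "?ip a = 0 \<or> ?ip b = 0" using f(2) unfolding ab map_of_int_mult by simp
    then have "degree b = 0 \<or> degree a = 0" using le[of a] le[of b] lc deg by auto
    then show "a dvd 1 \<or> b dvd 1" using unit lc by blast
  qed
  then have prime: "prime_elem f" by (rule irreducible_imp_prime_elem)
  let ?Q = "\<lambda>g. g \<noteq> 0 \<and> ?ip g = 0"
  obtain h where h: "?Q h" and hmin: "\<And>g. ?Q g \<Longrightarrow> degree h \<le> degree g"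
    using ex_has_least_nat[of ?Q f degree] f f0 by blast
  obtain a q where aq: "a \<noteq> 0" "smult a f = h * q + pseudo_mod f h"
    and r: "pseudo_mod f h = 0 \<or> degree (pseudo_mod f h) < degree h"
    using pseudo_mod[of h f] h by blast
  have "?ip (smult a f) = ?ip (h * q + pseudo_mod f h)" using aq by simp
  then have "?ip (pseudo_mod f h) = 0"
    using f(2) h by (simp add: map_of_int_smult map_of_int_mult map_of_int_add)
  then have "pseudo_mod f h = 0" using r hmin[of "pseudo_mod f h"] by (meson not_less)
  then have eq: "smult a f = h * q" using aq by simp
  then have "f dvd h * q" by (metis dvd_smult dvd_refl)
  then have "f dvd h \<or> f dvd q" using prime by (simp add: prime_elem_dvd_mult_iff)
  moreover have "q \<noteq> 0" using eq aq f0 by auto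
  moreover have "degree f = degree h + degree q"
    using eq aq(1) h \<open>q \<noteq> 0\<close> by (metis degree_mult_eq degree_smult_eq)
  moreover have "degree h \<noteq> 0" using nonconst h by auto
  ultimately have "degree f \<le> degree h"
    using dvd_imp_degree_le[of f h] dvd_imp_degree_le[of f q] h by auto
  then have "\<forall>g. g \<noteq> 0 \<longrightarrow> ?ip g = 0 \<longrightarrow> degree f \<le> degree g" using hmin by (meson le_trans)
  then show ?thesis using f c0 nonconst[OF f0 f(2)] by blast
qed

text \<open>The substitute for the norm: an algebraic integer that is smaller than 1 at every
  embedding is 0. The embedding sends \<open>\<beta>\<close> to a large root of its minimal
  polynomial and is then extended to all algebraic integers.\<close>

lemma exists_emb_norm_ge_1:
  fixes \<beta> :: "'a::field_char_0"
  assumes \<beta>: "algebraic_int \<beta>" "\<beta> \<noteq> 0"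
  shows "\<exists>\<sigma>. emb \<sigma> \<and> cmod (\<sigma> \<beta>) \<ge> 1"
proof -
  obtain f :: "int poly" where f: "lead_coeff f = 1" "coeff f 0 \<noteq> 0" "degree f \<noteq> 0"
      "poly (map_poly of_int f) \<beta> = 0"
    and min: "\<And>g. g \<noteq> 0 \<Longrightarrow> poly (map_poly of_int g) \<beta> = 0 \<Longrightarrow> degree f \<le> degree g"
    using monic_int_minimal_poly[OF \<beta>] by blast
  obtain b :: complex where b: "poly (map_poly of_int f) b = 0" "cmod b \<ge> 1"
    using exists_root_norm_ge_1[OF f(1-3)] by auto
  \<comment> \<open>The inverse of \<open>of_int\<close>, transported to the complex numbers; well
    defined on the integers in characteristic 0.\<close>
  define \<phi> :: "'a \<Rightarrow> complex" where "\<phi> a = of_int (THE n. a = of_int n)" for a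
  have \<phi>: "\<phi> (of_int n) = of_int n" for n unfolding \<phi>_def by simp
  have Z: "is_subring (\<int> :: 'a set)" by (rule is_subring_Ints)
  have hom: "hom_on (\<int> :: 'a set) \<phi>"
    unfolding hom_on_def
  proof (intro conjI ballI)
    show "\<phi> 1 = 1" using \<phi>[of 1] by simp
    fix x y :: 'a assume "x \<in> \<int>" "y \<in> \<int>"
    then obtain m n where "x = of_int m" "y = of_int n" by (metis Ints_cases)
    then show "\<phi> (x - y) = \<phi> x - \<phi> y" "\<phi> (x * y) = \<phi> x * \<phi> y"
      using \<phi>[of "m - n"] \<phi>[of "m * n"] \<phi> by auto
  qed
  have "\<exists>\<psi>. hom_on (adjoin \<int> \<beta>) \<psi> \<and> \<psi> \<beta> = b \<and> (\<forall>a\<in>\<int>. \<psi> a = \<phi> a)"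
  proof (rule extend_hom_to_root[OF Z hom])
    show "a = 0" if "a \<in> \<int>" "\<phi> a = 0" for a using that \<phi> by (auto elim!: Ints_cases)
    show "\<forall>i. coeff (map_poly of_int f) i \<in> (\<int> :: 'a set)" by (simp add: coeff_map_poly)
    show "map_poly of_int f \<noteq> (0 :: 'a poly)" using f(3) degree_map_of_int[of f, where 'a='a] by force
    show "poly (map_poly of_int f) \<beta> = 0" by (rule f)
    show "poly (map_poly \<phi> (map_poly of_int f)) b = 0" using b by (simp add: map_hom_of_int[OF Z hom])
    fix g :: "'a poly" assume g: "\<forall>i. coeff g i \<in> \<int>" "g \<noteq> 0" "poly g \<beta> = 0"
    then obtain g' where g': "g = map_poly of_int g'" using intpolyE by metis
    moreover have "g' \<noteq> 0" using g' g(2) by auto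
    ultimately show "degree (map_poly of_int f :: 'a poly) \<le> degree g"
      using min[of g'] g by (auto simp: degree_map_of_int)
  qed
  then obtain \<psi> where \<psi>: "hom_on (adjoin \<int> \<beta>) \<psi>" "\<psi> \<beta> = b" by blast
  have "adjoin \<int> \<beta> \<subseteq> {x. algebraic_int x}"
    by (rule adjoin_algebraic_int) (use \<beta> int_imp_algebraic_int in auto)
  then obtain \<sigma> where "emb \<sigma>" "\<forall>a\<in>adjoin \<int> \<beta>. \<sigma> a = \<psi> a"
    using extend_to_emb[OF is_subring_adjoin[OF Z] _ \<psi>(1)] by blast
  then show ?thesis using b(2) \<psi>(2) in_adjoin[OF Z, of \<beta>] by (intro exI[of _ \<sigma>]) auto
qed

context
  fixes \<sigma> :: "'a::field_char_0 \<Rightarrow> complex"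
  assumes \<sigma>: "emb \<sigma>"
begin

lemma emb_mult: "algebraic_int x \<Longrightarrow> algebraic_int y \<Longrightarrow> \<sigma> (x * y) = \<sigma> x * \<sigma> y"
  and emb_power: "algebraic_int x \<Longrightarrow> \<sigma> (x ^ n) = \<sigma> x ^ n"
  and emb_of_nat: "\<sigma> (of_nat n) = of_nat n"
  and emb_of_int: "\<sigma> (of_int m) = of_int m"
  and emb_eq_0_iff: "algebraic_int x \<Longrightarrow> \<sigma> x = 0 \<longleftrightarrow> x = 0"
  using hom_mult[OF is_subring_algebraic_int \<sigma>[unfolded emb_def]] hom_power[OF is_subring_algebraic_int \<sigma>[unfolded emb_def]]
    hom_of_nat[OF is_subring_algebraic_int \<sigma>[unfolded emb_def]] hom_of_int[OF is_subring_algebraic_int \<sigma>[unfolded emb_def]]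
    hom_eq_0_iff[OF is_subring_algebraic_int \<sigma>[unfolded emb_def]]
  by auto

lemma emb_sum: "(\<And>i. i \<in> I \<Longrightarrow> algebraic_int (f i)) \<Longrightarrow> \<sigma> (sum f I) = (\<Sum>i\<in>I. \<sigma> (f i))"
  by (rule hom_sum[OF is_subring_algebraic_int \<sigma>[unfolded emb_def]]) simp

end

lemma algebraic_int_mult: "algebraic_int x \<Longrightarrow> algebraic_int y \<Longrightarrow> algebraic_int (x * y :: 'a::field_char_0)"
  using subring_mult[OF is_subring_algebraic_int] by auto

lemma algebraic_int_power: "algebraic_int x \<Longrightarrow> algebraic_int (x ^ n :: 'a::field_char_0)"
  using subring_power[OF is_subring_algebraic_int] by auto

section \<open>Classes at a complex embedding\<close>

lemma sum_powr_int_less: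
  assumes "finite I" "\<And>i::int. i \<in> I \<Longrightarrow> i \<le> m"
  shows "(\<Sum>i\<in>I. 2 powr real_of_int i) < 2 powr (real_of_int m + 1)"
  using assms
proof (induction I arbitrary: m rule: finite_linorder_max_induct)
  case (insert b I)
  have "(\<Sum>i\<in>I. 2 powr real_of_int i) < 2 powr (real_of_int (b - 1) + 1)"
    by (rule insert.IH) (use insert.hyps in force)
  then have "(\<Sum>i\<in>insert b I. 2 powr real_of_int i) < 2 powr real_of_int b + 2 powr real_of_int b"
    using insert.hyps by (subst sum.insert) auto
  also have "\<dots> = 2 powr (real_of_int b + 1)" by (simp add: powr_add)
  also have "\<dots> \<le> 2 powr (real_of_int m + 1)" using insert.prems by (intro powr_mono) auto
  finally show ?case .
qed simp

text \<open>Equal parity keeps distinct values of \<open>g\<close> at least 2 apart. The terms other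
  than the largest are below \<open>2 powr (g x + 1)\<close>, with distinct exponents at most
  \<open>g d - 1\<close>, so together they stay below \<open>2 powr g d\<close> and cannot cancel
  it. Division by \<open>a\<close> is needed because only ratios are known to be algebraic
  integers.\<close>

lemma emb_dissociated:
  fixes A :: "'a::field_char_0 set"
  assumes \<sigma>: "emb \<sigma>" and A: "finite A" "0 \<notin> A" "card (subset_sums A) \<le> 2 ^ k"
    and int: "\<And>x y. x \<in> A \<Longrightarrow> y \<in> A \<Longrightarrow> algebraic_int (x / y)" and a: "a \<in> A"
    and D: "D \<subseteq> A" "inj_on g D" and g: "\<And>x. g x = \<lfloor>log 2 (cmod (\<sigma> (x / a)))\<rfloor>"
    and par: "\<And>x y. x \<in> D \<Longrightarrow> y \<in> D \<Longrightarrow> even (g x) \<longleftrightarrow> even (g y)"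
  shows "card D \<le> k"
proof (rule dissociated_card_le[OF A(1) D(1) A(3)], rule notI)
  fix E :: "'a set" and \<epsilon> :: "'a \<Rightarrow> int"
  assume E: "E \<subseteq> D" "E \<noteq> {}" "\<And>d. d \<in> E \<Longrightarrow> \<epsilon> d \<in> {-1, 1}" and 0: "(\<Sum>d\<in>E. of_int (\<epsilon> d) * d) = 0"
  have fE: "finite E" using E D A finite_subset by metis
  have EA: "x \<in> A" if "x \<in> E" for x using that E D by auto
  have inj: "inj_on g E" using D E inj_on_subset by blast
  have "Max (g ` E) \<in> g ` E" using fE E by (intro Max_in) auto
  then obtain d where d: "d \<in> E" "g d = Max (g ` E)" by auto
  have le: "g e + 1 \<le> g d - 1" if "e \<in> E - {d}" for e
  proof -
    have "g e \<le> g d" using that fE d by auto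
    moreover have "g e \<noteq> g d" using that inj_onD[OF inj _ _ d(1), of e] by auto
    moreover have "even (g e) \<longleftrightarrow> even (g d)" using par that d E by blast
    ultimately show ?thesis by presburger
  qed
  have pos: "cmod (\<sigma> (x / a)) > 0" if "x \<in> E" for x
  proof -
    have "algebraic_int (x / a)" "x / a \<noteq> 0" using int[OF EA[OF that] a] EA[OF that] a A(2) by auto
    then show ?thesis using emb_eq_0_iff[OF \<sigma>] by simp
  qed
  have up: "cmod (\<sigma> (x / a)) < 2 powr real_of_int (g x + 1)"
    and lo: "2 powr real_of_int (g x) \<le> cmod (\<sigma> (x / a))" if "x \<in> E" for x
  proof -
    have "log 2 (cmod (\<sigma> (x / a))) < real_of_int (g x + 1)" unfolding g by linarith
    then show "cmod (\<sigma> (x / a)) < 2 powr real_of_int (g x + 1)"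
      using pos[OF that] by (simp add: log_less_iff)
    have "real_of_int (g x) \<le> log 2 (cmod (\<sigma> (x / a)))" unfolding g by linarith
    then show "2 powr real_of_int (g x) \<le> cmod (\<sigma> (x / a))"
      using pos[OF that] by (simp add: le_log_iff)
  qed
  have alg: "algebraic_int (of_int (\<epsilon> x) * (x / a))" if "x \<in> E" for x
    using int[OF EA[OF that] a] by (intro algebraic_int_mult) auto
  have "(\<Sum>x\<in>E. of_int (\<epsilon> x) * (x / a)) = 0"
    using 0 by (simp flip: sum_divide_distrib)
  then have "\<sigma> (\<Sum>x\<in>E. of_int (\<epsilon> x) * (x / a)) = 0" using emb_of_int[OF \<sigma>, of 0] by simp
  moreover have "\<sigma> (\<Sum>x\<in>E. of_int (\<epsilon> x) * (x / a)) = (\<Sum>x\<in>E. \<sigma> (of_int (\<epsilon> x) * (x / a)))"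
    by (rule emb_sum[OF \<sigma> alg])
  moreover have "\<sigma> (of_int (\<epsilon> x) * (x / a)) = of_int (\<epsilon> x) * \<sigma> (x / a)" if "x \<in> E" for x
    using emb_mult[OF \<sigma> algebraic_int_of_int int[OF EA[OF that] a]] emb_of_int[OF \<sigma>] by simp
  ultimately have "(\<Sum>x\<in>E. of_int (\<epsilon> x) * \<sigma> (x / a)) = 0" by simp
  then have "of_int (\<epsilon> d) * \<sigma> (d / a) = - (\<Sum>x\<in>E - {d}. of_int (\<epsilon> x) * \<sigma> (x / a))"
    using sum.remove[OF fE d(1), of "\<lambda>x. of_int (\<epsilon> x) * \<sigma> (x / a)"] by (simp add: eq_neg_iff_add_eq_0)
  then have "cmod (of_int (\<epsilon> d) * \<sigma> (d / a)) \<le> (\<Sum>x\<in>E - {d}. cmod (of_int (\<epsilon> x) * \<sigma> (x / a)))"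
    by (simp add: norm_sum)
  moreover have "cmod (of_int (\<epsilon> x) * \<sigma> (x / a)) = cmod (\<sigma> (x / a))" if "x \<in> E" for x
    using E(3)[OF that] by (auto simp: norm_mult)
  ultimately have "cmod (\<sigma> (d / a)) \<le> (\<Sum>x\<in>E - {d}. cmod (\<sigma> (x / a)))" using d by simp
  also have "\<dots> \<le> (\<Sum>x\<in>E - {d}. 2 powr real_of_int (g x + 1))"
    by (intro sum_mono less_imp_le up) auto
  also have "\<dots> = (\<Sum>i\<in>(\<lambda>x. g x + 1) ` (E - {d}). 2 powr real_of_int i)"
    by (subst sum.reindex) (use inj in \<open>auto simp: inj_on_def\<close>)
  also have "\<dots> < 2 powr (real_of_int (g d - 1) + 1)"
    by (rule sum_powr_int_less) (use fE le in auto)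
  also have "\<dots> \<le> cmod (\<sigma> (d / a))" using lo[OF d(1)] by simp
  finally show False by simp
qed

text \<open>There are at most \<open>k\<close> dyadic exponents of each parity, and every dyadic
  interval is cut into \<open>Q\<close> pieces of equal logarithmic length, which gives
  \<open>2 * k * Q\<close> classes. Within a piece binary logarithms differ by less than
  \<open>1 / Q\<close>, and natural ones by even less.\<close>

lemma emb_classes:
  fixes A :: "'a::field_char_0 set"
  assumes \<sigma>: "emb \<sigma>" and A: "finite A" "0 \<notin> A" "card (subset_sums A) \<le> 2 ^ k"
    and int: "\<And>x y. x \<in> A \<Longrightarrow> y \<in> A \<Longrightarrow> algebraic_int (x / y)" and Q: "Q \<ge> 1"
  shows "\<exists>B\<subseteq>A. card A \<le> 2 * k * Q * card B \<and> (\<forall>x\<in>B. \<forall>y\<in>B. \<bar>ln (cmod (\<sigma> (x / y)))\<bar> \<le> 1 / real Q)"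
proof (cases "A = {}")
  case False
  then obtain a where a: "a \<in> A" by auto
  define l where "l x = log 2 (cmod (\<sigma> (x / a)))" for x
  define g where "g x = \<lfloor>log 2 (cmod (\<sigma> (x / a)))\<rfloor>" for x
  define f where "f x = \<lfloor>real Q * l x\<rfloor>" for x
  have half: "card {i \<in> g ` A. even i = b} \<le> k" for b
  proof -
    have "{i \<in> g ` A. even i = b} \<subseteq> g ` A" by auto
    then obtain D where D: "D \<subseteq> A" "inj_on g D" "{i \<in> g ` A. even i = b} = g ` D"
      by (auto simp: subset_image_inj)
    have par: "even (g x) \<longleftrightarrow> even (g y)" if "x \<in> D" "y \<in> D" for x y using D(3) that by blast
    have "card D \<le> k" by (rule emb_dissociated[OF \<sigma> A int a D(1,2) g_def par])
    then show ?thesis unfolding D(3) using D(2) by (simp add: card_image)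
  qed
  have "card (g ` A) \<le> card ({i \<in> g ` A. even i = True} \<union> {i \<in> g ` A. even i = False})"
    using A by (intro card_mono) auto
  also have "\<dots> \<le> k + k" by (rule order_trans[OF card_Un_le add_mono[OF half half]])
  finally have cg: "card (g ` A) \<le> 2 * k" by simp
  have "f ` A \<subseteq> (\<Union>i\<in>g ` A. {int Q * i..<int Q * (i + 1)})"
  proof clarify
    fix x assume "x \<in> A"
    have "real_of_int (g x) \<le> l x" "l x < real_of_int (g x + 1)" unfolding g_def l_def by linarith+
    then have "real Q * real_of_int (g x) \<le> real Q * l x" "real Q * l x < real Q * real_of_int (g x + 1)"
      using Q by (auto intro: mult_left_mono mult_strict_left_mono simp del: of_int_add)
    then have "real_of_int (int Q * g x) \<le> real Q * l x" "real Q * l x < real_of_int (int Q * (g x + 1))"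
      by auto
    then have "int Q * g x \<le> f x" "f x < int Q * (g x + 1)"
      unfolding f_def by (simp_all only: le_floor_iff floor_less_iff)
    then show "f x \<in> (\<Union>i\<in>g ` A. {int Q * i..<int Q * (i + 1)})" using \<open>x \<in> A\<close> by auto
  qed
  then have "card (f ` A) \<le> card (\<Union>i\<in>g ` A. {int Q * i..<int Q * (i + 1)})"
    using A by (intro card_mono) auto
  also have "\<dots> \<le> (\<Sum>i\<in>g ` A. card {int Q * i..<int Q * (i + 1)})"
    using A by (intro card_UN_le) auto
  also have "\<dots> = card (g ` A) * Q" by (simp add: algebra_simps)
  also have "\<dots> \<le> 2 * k * Q" using cg by simp
  finally obtain B where B: "B \<subseteq> A" "card A \<le> 2 * k * Q * card B" "\<And>x y. x \<in> B \<Longrightarrow> y \<in> B \<Longrightarrow> f x = f y"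
    using popular_fibre[OF A(1)] by metis
  have "\<bar>ln (cmod (\<sigma> (x / y)))\<bar> \<le> 1 / real Q" if xy: "x \<in> B" "y \<in> B" for x y
  proof -
    have xyA: "x \<in> A" "y \<in> A" using xy B by auto
    have nz: "x \<noteq> 0" "y \<noteq> 0" "a \<noteq> 0" using xyA a A by auto
    have "\<sigma> (x / a) = \<sigma> (x / y) * \<sigma> (y / a)"
      using emb_mult[OF \<sigma> int[OF xyA] int[OF xyA(2) a]] nz by simp
    moreover have "\<sigma> (x / y) \<noteq> 0" "\<sigma> (y / a) \<noteq> 0"
      using emb_eq_0_iff[OF \<sigma> int[OF xyA]] emb_eq_0_iff[OF \<sigma> int[OF xyA(2) a]] nz by auto
    ultimately have "l x - l y = log 2 (cmod (\<sigma> (x / y)))"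
      unfolding l_def by (simp add: norm_mult log_mult)
    then have eq: "ln (cmod (\<sigma> (x / y))) = ln 2 * (l x - l y)" by (simp add: log_def)
    have "\<lfloor>real Q * l x\<rfloor> = \<lfloor>real Q * l y\<rfloor>" using B(3)[OF xy] unfolding f_def .
    then have "\<bar>real Q * l x - real Q * l y\<bar> < 1" by linarith
    then have "real Q * \<bar>l x - l y\<bar> < 1" using Q by (simp add: abs_mult flip: right_diff_distrib)
    then have "\<bar>l x - l y\<bar> \<le> 1 / real Q" using Q by (simp add: field_simps)
    moreover have "ln (2::real) \<le> 1" using ln_2_less_1 by simp
    ultimately have "ln 2 * \<bar>l x - l y\<bar> \<le> 1 * (1 / real Q)" by (intro mult_mono) auto
    then show ?thesis unfolding eq by (simp add: abs_mult)
  qed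
  then show ?thesis using B by blast
qed auto

section \<open>Relations of Frobenius type\<close>

text \<open>In place of a determinant, the polynomial \<open>g\<close> vanishing at all nodes except
  \<open>v k\<close> combines the power sums into \<open>a k * poly g (v k)\<close>.\<close>

lemma vandermonde_zero:
  fixes v a :: "'b \<Rightarrow> 'a::field"
  assumes I: "finite I" "inj_on v I" and 0: "\<And>j. j < card I \<Longrightarrow> (\<Sum>i\<in>I. a i * v i ^ j) = 0"
    and k: "k \<in> I"
  shows "a k = 0"
proof -
  define g where "g = (\<Prod>i\<in>I - {k}. [:- v i, 1:])"
  have "degree g \<le> (\<Sum>i\<in>I - {k}. degree [:- v i, 1:])"
    unfolding g_def using degree_prod_sum_le[of "I - {k}" "\<lambda>i. [:- v i, 1:]"] I by (simp add: o_def)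
  also have "\<dots> = card I - 1" using I k by simp
  finally have "degree g \<le> card I - 1" .
  moreover have "card I > 0" using I k card_gt_0_iff by blast
  ultimately have dg: "degree g < card I" by linarith
  have "(\<Sum>i\<in>I. a i * poly g (v i)) = (\<Sum>i\<in>I. \<Sum>j\<le>degree g. coeff g j * (a i * v i ^ j))"
    by (simp add: poly_altdef sum_distrib_left mult_ac)
  also have "\<dots> = (\<Sum>j\<le>degree g. coeff g j * (\<Sum>i\<in>I. a i * v i ^ j))"
    by (subst sum.swap) (simp add: sum_distrib_left)
  also have "\<dots> = 0" using 0 dg by (intro sum.neutral) auto
  finally have "(\<Sum>i\<in>I. a i * poly g (v i)) = 0" .
  moreover have "poly g (v i) = 0" if "i \<in> I - {k}" for i
    unfolding g_def poly_prod using that I by (intro prod_zero) auto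
  ultimately have "a k * poly g (v k) = 0"
    using sum.remove[OF I(1) k, of "\<lambda>i. a i * poly g (v i)"] by simp
  moreover have "poly g (v k) \<noteq> 0"
    unfolding g_def poly_prod using I k by (auto simp: prod_zero_iff dest: inj_onD)
  ultimately show ?thesis by simp
qed

lemma freshman_add:
  fixes R :: "'a::field set"
  assumes R: "is_subring R" and p: "prime p" and xy: "x \<in> R" "y \<in> R"
  shows "\<exists>b\<in>R. (x + y) ^ p = x ^ p + y ^ p + of_nat p * b"
proof -
  let ?b = "\<Sum>k\<in>{1..<p}. of_nat ((p choose k) div p) * x ^ k * y ^ (p - k)"
  have p1: "p \<ge> 2" using p prime_ge_2_nat by auto
  have choose: "of_nat (p choose k) = (of_nat p * of_nat ((p choose k) div p) :: 'a)" if "k \<in> {1..<p}" for k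
  proof -
    have "p dvd p choose k" using that p by (intro dvd_choose_prime) auto
    then have "p choose k = p * ((p choose k) div p)" by simp
    then show ?thesis by (metis of_nat_mult)
  qed
  have "{..p} = insert 0 (insert p {1..<p})" using p1 by auto
  then have "(x + y) ^ p = y ^ p + (x ^ p + (\<Sum>k\<in>{1..<p}. of_nat (p choose k) * x ^ k * y ^ (p - k)))"
    unfolding binomial_ring using p1 by simp
  also have "(\<Sum>k\<in>{1..<p}. of_nat (p choose k) * x ^ k * y ^ (p - k)) = of_nat p * ?b"
    unfolding sum_distrib_left by (rule sum.cong) (use choose in \<open>simp_all add: mult_ac\<close>)
  finally have "(x + y) ^ p = x ^ p + y ^ p + of_nat p * ?b" by simp
  moreover have "?b \<in> R"
    using xy by (intro subring_sum[OF R] subring_mult[OF R] subring_of_nat[OF R] subring_power[OF R])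
  ultimately show ?thesis by blast
qed

lemma freshman_sum:
  fixes R :: "'a::field set"
  assumes R: "is_subring R" and p: "prime p" and "finite I"
  shows "(\<And>i. i \<in> I \<Longrightarrow> y i \<in> R) \<Longrightarrow> \<exists>b\<in>R. (\<Sum>i\<in>I. y i) ^ p = (\<Sum>i\<in>I. y i ^ p) + of_nat p * b"
  using assms(3)
proof (induction I rule: finite_induct)
  case empty
  then show ?case using p subring_0[OF R] prime_gt_0_nat by (intro bexI[of _ 0]) auto
next
  case (insert i I)
  obtain b where b: "b \<in> R" "(\<Sum>i\<in>I. y i) ^ p = (\<Sum>i\<in>I. y i ^ p) + of_nat p * b" using insert by auto
  have "(\<Sum>i\<in>I. y i) \<in> R" using insert.prems by (intro subring_sum[OF R]) auto
  then obtain c where c: "c \<in> R"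
    "(y i + (\<Sum>i\<in>I. y i)) ^ p = y i ^ p + (\<Sum>i\<in>I. y i) ^ p + of_nat p * c"
    using freshman_add[OF R p, of "y i" "\<Sum>i\<in>I. y i"] insert.prems by auto
  have "(\<Sum>i\<in>insert i I. y i) ^ p = (\<Sum>i\<in>insert i I. y i ^ p) + of_nat p * (b + c)"
    using insert.hyps b c by (simp add: algebra_simps)
  then show ?case using b c subring_add[OF R] by blast
qed

text \<open>If \<open>\<Sum> \<epsilon>\<^sub>i x\<^sub>i = 0\<close> then \<open>\<Sum> \<epsilon>\<^sub>i x\<^sub>i\<^sup>p\<close> is \<open>p\<close> times an algebraic integer all of whose
  conjugates have modulus less than 1.\<close>

lemma frobenius_relation:
  fixes x :: "'b \<Rightarrow> 'a::field_char_0"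
  assumes I: "finite I" and p: "prime p" "2 * card I < p" "odd p"
    and \<epsilon>: "\<And>i. i \<in> I \<Longrightarrow> \<epsilon> i \<in> {-1, 1::int}" and x: "\<And>i. i \<in> I \<Longrightarrow> algebraic_int (x i)"
    and rel: "(\<Sum>i\<in>I. of_int (\<epsilon> i) * x i) = 0"
    and small: "\<And>\<sigma> i. emb \<sigma> \<Longrightarrow> i \<in> I \<Longrightarrow> cmod (\<sigma> (x i)) ^ p \<le> 2"
  shows "(\<Sum>i\<in>I. of_int (\<epsilon> i) * x i ^ p) = 0"
proof -
  have alg: "algebraic_int (of_int (\<epsilon> i) * x i ^ p)" "algebraic_int (of_int (\<epsilon> i) * x i)" if "i \<in> I" for i
    using x[OF that] by (auto intro!: algebraic_int_mult algebraic_int_power)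
  obtain b where b: "algebraic_int b"
    "(\<Sum>i\<in>I. of_int (\<epsilon> i) * x i) ^ p = (\<Sum>i\<in>I. (of_int (\<epsilon> i) * x i) ^ p) + of_nat p * b"
    using freshman_sum[OF is_subring_algebraic_int p(1) I, of "\<lambda>i. of_int (\<epsilon> i) * x i"] alg(2) by auto
  \<comment> \<open>An odd power preserves the sign \<open>\<epsilon> i\<close>, so the new relation
    has the same coefficients.\<close>
  have "(of_int (\<epsilon> i) * x i) ^ p = of_int (\<epsilon> i) * x i ^ p" if "i \<in> I" for i
    using \<epsilon>[OF that] p(3) by (auto simp: power_mult_distrib)
  then have eq: "(\<Sum>i\<in>I. of_int (\<epsilon> i) * x i ^ p) = of_nat p * (- b)"
    using b(2) rel prime_gt_0_nat[OF p(1)] by (simp add: eq_neg_iff_add_eq_0 zero_power)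
  have "b = 0"
  proof (rule ccontr)
    assume "b \<noteq> 0"
    then obtain \<sigma> where \<sigma>: "emb \<sigma>" "cmod (\<sigma> (- b)) \<ge> 1"
      using exists_emb_norm_ge_1[of "- b"] b(1) by auto
    have "\<sigma> (of_nat p * (- b)) = of_nat p * \<sigma> (- b)"
      using emb_mult[OF \<sigma>(1), of "of_nat p" "- b"] emb_of_nat[OF \<sigma>(1)] b(1) by simp
    then have "real p * cmod (\<sigma> (- b)) = cmod (\<sigma> (\<Sum>i\<in>I. of_int (\<epsilon> i) * x i ^ p))"
      unfolding eq by (simp add: norm_mult)
    also have "\<sigma> (\<Sum>i\<in>I. of_int (\<epsilon> i) * x i ^ p) = (\<Sum>i\<in>I. \<sigma> (of_int (\<epsilon> i) * x i ^ p))"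
      by (rule emb_sum[OF \<sigma>(1) alg(1)])
    also have "cmod \<dots> \<le> (\<Sum>i\<in>I. cmod (\<sigma> (of_int (\<epsilon> i) * x i ^ p)))" by (rule norm_sum)
    also have "\<dots> \<le> (\<Sum>i\<in>I. 2)"
    proof (rule sum_mono)
      fix i assume i: "i \<in> I"
      have "\<sigma> (of_int (\<epsilon> i) * x i ^ p) = of_int (\<epsilon> i) * \<sigma> (x i) ^ p"
        using emb_mult[OF \<sigma>(1) algebraic_int_of_int algebraic_int_power[OF x[OF i]]]
          emb_of_int[OF \<sigma>(1)] emb_power[OF \<sigma>(1) x[OF i]] by simp
      then show "cmod (\<sigma> (of_int (\<epsilon> i) * x i ^ p)) \<le> 2"
        using small[OF \<sigma>(1) i] \<epsilon>[OF i] by (auto simp: norm_mult norm_power)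
    qed
    also have "\<dots> < real p" using p(2) by simp
    finally show False using \<sigma>(2) mult_left_mono[OF \<sigma>(2), of "real p"] by simp
  qed
  then show ?thesis using eq by simp
qed

text \<open>Prime factors of \<open>n\<close> are split off one at a time: with
  \<open>n = p * m\<close>, the relation for \<open>m\<close> enters the Frobenius step with the
  elements \<open>x i ^ m\<close>, whose \<open>p\<close>-th powers are the \<open>n\<close>-th
  powers bounded by assumption.\<close>

lemma power_relation:
  fixes x :: "'b \<Rightarrow> 'a::field_char_0"
  assumes I: "finite I" "I \<noteq> {}"
    and \<epsilon>: "\<And>i. i \<in> I \<Longrightarrow> \<epsilon> i \<in> {-1, 1::int}" and x: "\<And>i. i \<in> I \<Longrightarrow> algebraic_int (x i)"
    and rel: "(\<Sum>i\<in>I. of_int (\<epsilon> i) * x i) = 0"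
    and small: "\<And>\<sigma> i n. emb \<sigma> \<Longrightarrow> i \<in> I \<Longrightarrow> n \<le> X \<Longrightarrow> cmod (\<sigma> (x i)) ^ n \<le> 2"
  shows "n \<ge> 1 \<Longrightarrow> n \<le> X \<Longrightarrow> (\<And>p. prime p \<Longrightarrow> p dvd n \<Longrightarrow> 2 * card I < p) \<Longrightarrow>
    (\<Sum>i\<in>I. of_int (\<epsilon> i) * x i ^ n) = 0"
proof (induction n rule: less_induct)
  case (less n)
  show ?case
  proof (cases "n = 1")
    case False
    then obtain p where p: "prime p" "p dvd n" using prime_factor_nat[of n] by auto
    then obtain m where m: "n = p * m" by auto
    have cI: "card I \<ge> 1" using I by (simp add: Suc_leI card_gt_0_iff)
    have p2: "2 * card I < p" using less.prems p by auto
    then have odd: "odd p" using p(1) cI by (intro prime_odd_nat) auto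
    have m1: "m \<ge> 1" "m < n" using less.prems(1) m p(1) prime_gt_1_nat[of p] by (auto intro: Suc_leI)
    have "(\<Sum>i\<in>I. of_int (\<epsilon> i) * x i ^ m) = 0"
      using less.IH[of m] less.prems m1 m by (meson dvd_mult less_imp_le_nat order_trans)
    moreover have "cmod (\<sigma> (x i ^ m)) ^ p \<le> 2" if "emb \<sigma>" "i \<in> I" for \<sigma> i
      using small[OF that, of n] less.prems(2) emb_power[OF that(1) x[OF that(2)]] m
      by (simp add: norm_power mult.commute flip: power_mult)
    ultimately have "(\<Sum>i\<in>I. of_int (\<epsilon> i) * (x i ^ m) ^ p) = 0"
      using x by (intro frobenius_relation[OF I(1) p(1) p2 odd \<epsilon>] algebraic_int_power) auto
    then show ?thesis unfolding m by (simp add: mult.commute flip: power_mult)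
  qed (use rel in simp)
qed

text \<open>Every prime up to \<open>4 * h\<close> divides \<open>fact (4 * h)\<close>, so the
  exponents \<open>1 + j * fact (4 * h)\<close> have only prime factors above \<open>4 * h\<close>,
  which is at least \<open>2 * card E\<close>. The relations for \<open>j < card E\<close> form a
  Vandermonde system with distinct nodes, so its coefficients would vanish, although they are signs
  times nonzero elements.\<close>

lemma no_short_relation:
  fixes E :: "'a::field_char_0 set"
  assumes E: "finite E" "E \<noteq> {}" "card E \<le> 2 * h" "0 \<notin> E" and b: "b \<noteq> 0"
    and alg: "\<And>x. x \<in> E \<Longrightarrow> algebraic_int (x / b)" and \<epsilon>: "\<And>x. x \<in> E \<Longrightarrow> \<epsilon> x \<in> {-1, 1::int}"
    and small: "\<And>\<sigma> x n. emb \<sigma> \<Longrightarrow> x \<in> E \<Longrightarrow> n \<le> 1 + 2 * h * fact (4 * h) \<Longrightarrow> cmod (\<sigma> (x / b)) ^ n \<le> 2"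
    and inj: "inj_on (\<lambda>x. (x / b) ^ fact (4 * h)) E"
  shows "(\<Sum>x\<in>E. of_int (\<epsilon> x) * x) \<noteq> 0"
proof
  assume "(\<Sum>x\<in>E. of_int (\<epsilon> x) * x) = 0"
  then have rel: "(\<Sum>x\<in>E. of_int (\<epsilon> x) * (x / b)) = 0" by (simp flip: sum_divide_distrib)
  let ?q = "fact (4 * h) :: nat"
  have "(\<Sum>x\<in>E. (of_int (\<epsilon> x) * (x / b)) * ((x / b) ^ ?q) ^ j) = 0" if j: "j < card E" for j
  proof -
    have "j * ?q \<le> 2 * h * ?q" using j E(3) by (intro mult_right_mono) auto
    moreover have "2 * card E < p" if p: "prime p" "p dvd 1 + j * ?q" for p
    proof (rule ccontr)
      assume "\<not> 2 * card E < p"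
      then have "p dvd ?q" using E(3) p prime_gt_0_nat[of p] by (intro dvd_fact) auto
      then have "p dvd 1" using p(2) by (metis dvd_add_left_iff dvd_mult)
      then show False using p(1) by simp
    qed
    ultimately have "(\<Sum>x\<in>E. of_int (\<epsilon> x) * (x / b) ^ (1 + j * ?q)) = 0"
      by (intro power_relation[where x = "\<lambda>x. x / b" and X = "1 + 2 * h * ?q"] E(1,2) \<epsilon> alg rel small) auto
    then show ?thesis by (simp add: power_add power_mult mult_ac flip: power_mult)
  qed
  then have "of_int (\<epsilon> x) * (x / b) = 0" if "x \<in> E" for x
    using vandermonde_zero[OF E(1) inj, of "\<lambda>x. of_int (\<epsilon> x) * (x / b)" x] that by blast
  then show False using E b \<epsilon> by fastforce
qed

section \<open>Ratios of small height\<close>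

text \<open>A quantitative form of multiplicative independence; unlike \<^const>\<open>mult_indep\<close> it can be
  extended by one more element that is large at some embedding at which the old elements are small.\<close>

definition robust_indep :: "nat \<Rightarrow> real \<Rightarrow> (nat \<Rightarrow> 'a::field_char_0) \<Rightarrow> bool" where
  "robust_indep r c w \<longleftrightarrow> (\<forall>n::nat \<Rightarrow> real. \<exists>\<sigma>. emb \<sigma> \<and>
     c * (\<Sum>i<r. \<bar>n i\<bar>) \<le> \<bar>\<Sum>i<r. n i * ln (cmod (\<sigma> (w i)))\<bar>)"

lemma algebraic_int_prod:
  "(\<And>i. i \<in> I \<Longrightarrow> algebraic_int (f i)) \<Longrightarrow> algebraic_int (\<Prod>i\<in>I. f i :: 'a::field_char_0)"
  by (induction I rule: infinite_finite_induct) (auto intro: algebraic_int_mult)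

lemma emb_prod:
  assumes "emb \<sigma>"
  shows "(\<And>i. i \<in> I \<Longrightarrow> algebraic_int (f i)) \<Longrightarrow> \<sigma> (\<Prod>i\<in>I. f i) = (\<Prod>i\<in>I. \<sigma> (f i))"
  using emb_of_nat[OF assms, of 1]
  by (induction I rule: infinite_finite_induct) (auto simp: emb_mult[OF assms] algebraic_int_prod)

lemma emb_unit_powi:
  assumes \<sigma>: "emb \<sigma>" and x: "algebraic_int x" "algebraic_int (inverse x)" "x \<noteq> 0"
  shows "algebraic_int (x powi n)" "\<sigma> (x powi n) = \<sigma> x powi n"
proof -
  have "\<sigma> x * \<sigma> (inverse x) = 1"
    using emb_mult[OF \<sigma> x(1,2)] x(3) emb_of_nat[OF \<sigma>, of 1] by simp
  then have "\<sigma> (inverse x) = inverse (\<sigma> x)" by (rule inverse_unique[symmetric])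
  note inv = this
  have neg: "y powi (- int m) = inverse y ^ m" for y :: "'b::field" and m
    by (simp add: power_int_minus power_inverse)
  have "algebraic_int (x powi n) \<and> \<sigma> (x powi n) = \<sigma> x powi n"
  proof (cases n rule: int_cases2)
    case (nonneg m)
    then show ?thesis using x emb_power[OF \<sigma>] algebraic_int_power by simp
  next
    case (nonpos m)
    show ?thesis unfolding nonpos neg using x emb_power[OF \<sigma> x(2)] algebraic_int_power inv by simp
  qed
  then show "algebraic_int (x powi n)" "\<sigma> (x powi n) = \<sigma> x powi n" by auto
qed

lemma ratio_unit:
  assumes "\<And>x y. x \<in> A \<Longrightarrow> y \<in> A \<Longrightarrow> algebraic_int (x / y)" "0 \<notin> A" "u \<in> ratios A"
  shows "algebraic_int u" "algebraic_int (inverse u)" "u \<noteq> 0"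
  using assms unfolding ratios_def by auto

text \<open>Logarithms of moduli turn a multiplicative relation into a linear one at every embedding
  simultaneously, and at one of them the lower bound forces all exponents to be 0.\<close>

lemma robust_imp_mult_indep:
  fixes w :: "nat \<Rightarrow> 'a::field_char_0"
  assumes rob: "robust_indep r c w" "c > 0"
    and w: "\<And>i. i < r \<Longrightarrow> algebraic_int (w i) \<and> algebraic_int (inverse (w i)) \<and> w i \<noteq> 0"
  shows "mult_indep r w"
  unfolding mult_indep_def
proof (intro allI impI)
  fix n :: "nat \<Rightarrow> int" and k assume eq: "(\<Prod>i<r. w i powi n i) = 1" and k: "k < r"
  obtain \<sigma> where \<sigma>: "emb \<sigma>"
    "c * (\<Sum>i<r. \<bar>real_of_int (n i)\<bar>) \<le> \<bar>\<Sum>i<r. real_of_int (n i) * ln (cmod (\<sigma> (w i)))\<bar>"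
    using rob unfolding robust_indep_def by meson
  have pos: "cmod (\<sigma> (w i)) > 0" if "i < r" for i
    using w[OF that] emb_eq_0_iff[OF \<sigma>(1)] by auto
  have "1 = cmod (\<sigma> (\<Prod>i<r. w i powi n i))" using eq emb_of_nat[OF \<sigma>(1), of 1] by simp
  also have "\<sigma> (\<Prod>i<r. w i powi n i) = (\<Prod>i<r. \<sigma> (w i) powi n i)"
    using emb_prod[OF \<sigma>(1), of "{..<r}" "\<lambda>i. w i powi n i"] emb_unit_powi[OF \<sigma>(1)] w by simp
  finally have "1 = (\<Prod>i<r. cmod (\<sigma> (w i)) powi n i)" by (simp add: norm_power_int flip: prod_norm)
  also have "\<dots> = (\<Prod>i<r. exp (real_of_int (n i) * ln (cmod (\<sigma> (w i)))))"
  proof (rule prod.cong)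
    fix i assume "i \<in> {..<r}"
    then have "cmod (\<sigma> (w i)) powi n i = cmod (\<sigma> (w i)) powr real_of_int (n i)"
      using pos[of i] by (simp add: powr_real_of_int')
    then show "cmod (\<sigma> (w i)) powi n i = exp (real_of_int (n i) * ln (cmod (\<sigma> (w i))))"
      using pos[of i] \<open>i \<in> {..<r}\<close> by (simp add: powr_def)
  qed simp
  also have "\<dots> = exp (\<Sum>i<r. real_of_int (n i) * ln (cmod (\<sigma> (w i))))" by (simp add: exp_sum)
  finally have "(\<Sum>i<r. real_of_int (n i) * ln (cmod (\<sigma> (w i)))) = 0" by simp
  then have "c * (\<Sum>i<r. \<bar>real_of_int (n i)\<bar>) \<le> 0" using \<sigma>(2) by simp
  then have "(\<Sum>i<r. \<bar>real_of_int (n i)\<bar>) \<le> 0" using rob(2) by (simp add: mult_le_0_iff)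
  moreover have "\<bar>real_of_int (n k)\<bar> \<le> (\<Sum>i<r. \<bar>real_of_int (n i)\<bar>)"
    using k by (intro member_le_sum) auto
  ultimately show "n k = 0" by simp
qed

text \<open>All values are roots of one integer polynomial. Hence some embedding maximises the
  logarithmic size of a given ratio, as extending robust independence demands.\<close>

lemma finite_emb_values:
  fixes x :: "'a::field_char_0"
  assumes "algebraic_int x"
  shows "finite {\<sigma> x | \<sigma>. emb \<sigma>}"
proof -
  obtain p where p: "poly (map_poly of_int p) x = 0" "lead_coeff p = 1"
    using assms unfolding algebraic_int_altdef_ipoly by auto
  then have "p \<noteq> 0" by auto
  then have "map_poly of_int p \<noteq> (0 :: complex poly)"
    by (metis degree_map_of_int leading_coeff_0_iff coeff_map_poly of_int_0 of_int_eq_0_iff)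
  moreover have "poly (map_poly of_int p) (\<sigma> x) = 0" if "emb \<sigma>" for \<sigma>
    using hom_ipoly[OF is_subring_algebraic_int that[unfolded emb_def], of x p] assms p
      emb_of_nat[OF that, of 0] by simp
  then have "{\<sigma> x | \<sigma>. emb \<sigma>} \<subseteq> {z. poly (map_poly of_int p) z = 0}" by auto
  ultimately show ?thesis using poly_roots_finite finite_subset by blast
qed

text \<open>If the term of \<open>u\<close> can reach half of \<open>c * N\<close>, the combination
  is evaluated at \<open>\<sigma>\<close>, where \<open>u\<close> is as large as anywhere and the
  old elements contribute at most \<open>c * N / 4\<close>. Otherwise it is evaluated at the
  embedding \<open>\<tau>\<close> provided by the old elements, where \<open>u\<close> cancels less
  than half.\<close>

lemma robust_indep_extend:
  fixes w :: "nat \<Rightarrow> 'a::field_char_0"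
  assumes rob: "robust_indep r c w" and \<eta>: "0 < \<eta>" "\<eta> \<le> 1" and c: "0 < c" "c \<le> 1"
    and \<sigma>: "emb \<sigma>" "\<And>\<tau>. emb \<tau> \<Longrightarrow> \<bar>ln (cmod (\<tau> u))\<bar> \<le> \<bar>ln (cmod (\<sigma> u))\<bar>"
    and u: "\<eta> < \<bar>ln (cmod (\<sigma> u))\<bar>" and w: "\<And>i. i < r \<Longrightarrow> \<bar>ln (cmod (\<sigma> (w i)))\<bar> \<le> c / 4"
  shows "robust_indep (Suc r) (\<eta> / 6 * c) (w(r := u))"
  unfolding robust_indep_def
proof
  fix n :: "nat \<Rightarrow> real"
  define R where "R = \<bar>ln (cmod (\<sigma> u))\<bar>"
  define N where "N = (\<Sum>i<r. \<bar>n i\<bar>)"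
  have N: "N \<ge> 0" unfolding N_def by (simp add: sum_nonneg)
  obtain \<tau> where \<tau>: "emb \<tau>" "c * N \<le> \<bar>\<Sum>i<r. n i * ln (cmod (\<tau> (w i)))\<bar>"
    using rob unfolding robust_indep_def N_def by meson
  have "\<bar>n r * ln (cmod (\<tau> u))\<bar> \<le> \<bar>n r\<bar> * R"
    unfolding abs_mult R_def using \<sigma>(2)[OF \<tau>(1)] by (intro mult_left_mono) auto
  then have 1: "c * N - \<bar>n r\<bar> * R \<le> \<bar>(\<Sum>i<r. n i * ln (cmod (\<tau> (w i)))) + n r * ln (cmod (\<tau> u))\<bar>"
    using \<tau>(2) by linarith
  have "\<bar>\<Sum>i<r. n i * ln (cmod (\<sigma> (w i)))\<bar> \<le> (\<Sum>i<r. \<bar>n i\<bar> * (c / 4))"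
  proof (rule order_trans[OF sum_abs], rule sum_mono)
    fix i assume "i \<in> {..<r}"
    then show "\<bar>n i * ln (cmod (\<sigma> (w i)))\<bar> \<le> \<bar>n i\<bar> * (c / 4)"
      unfolding abs_mult using w[of i] by (intro mult_left_mono) auto
  qed
  also have "\<dots> = c * N / 4" unfolding N_def by (simp add: sum_distrib_left sum_distrib_right mult_ac)
  finally have "\<bar>\<Sum>i<r. n i * ln (cmod (\<sigma> (w i)))\<bar> \<le> c * N / 4" .
  moreover have "\<bar>n r * ln (cmod (\<sigma> u))\<bar> = \<bar>n r\<bar> * R" unfolding R_def by (simp add: abs_mult)
  ultimately have 2: "\<bar>n r\<bar> * R - c * N / 4 \<le> \<bar>(\<Sum>i<r. n i * ln (cmod (\<sigma> (w i)))) + n r * ln (cmod (\<sigma> u))\<bar>"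
    by linarith
  have a: "\<eta> * c * \<bar>n r\<bar> \<le> R * \<bar>n r\<bar>"
  proof (rule mult_right_mono)
    have "\<eta> * c \<le> \<eta> * 1" using c \<eta> by (intro mult_left_mono) auto
    then show "\<eta> * c \<le> R" using u unfolding R_def by simp
  qed simp
  have b: "\<eta> * (c * N) \<le> c * N" using \<eta> c N by (intro mult_left_le_one_le) auto
  have lhs: "\<eta> / 6 * c * (N + \<bar>n r\<bar>) = (\<eta> * (c * N) + \<eta> * c * \<bar>n r\<bar>) / 6"
    by (simp add: field_simps)
  have "\<exists>\<rho>. emb \<rho> \<and> \<eta> / 6 * c * (N + \<bar>n r\<bar>) \<le> \<bar>(\<Sum>i<r. n i * ln (cmod (\<rho> (w i)))) + n r * ln (cmod (\<rho> u))\<bar>"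
  proof (cases "\<bar>n r\<bar> * R \<ge> c * N / 2")
    case True
    \<comment> \<open>Here the 6 is used up exactly: \<open>E + F \<le> 3 * P\<close>, whereas
      \<open>P - M / 4\<close> is only known to be at least \<open>P / 2\<close>.\<close>
    have lin: "(E + F) / 6 \<le> P - M / 4" if "M / 2 \<le> P" "F \<le> P" "E \<le> M" for M P E F :: real
      using that by argo
    have *: "\<eta> / 6 * c * (N + \<bar>n r\<bar>) \<le> \<bar>n r\<bar> * R - c * N / 4"
      unfolding lhs by (rule lin[OF True _ b]) (use a in \<open>simp add: mult.commute[of R]\<close>)
    then show ?thesis using order_trans[OF * 2] \<sigma>(1) by blast
  next
    case False
    have lin: "(E + F) / 6 \<le> M - P" if "0 \<le> M" "\<not> M / 2 \<le> P" "F \<le> P" "E \<le> M" for M P E F :: real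
      using that by argo
    have *: "\<eta> / 6 * c * (N + \<bar>n r\<bar>) \<le> c * N - \<bar>n r\<bar> * R"
      unfolding lhs by (rule lin[OF _ False _ b]) (use a c N in \<open>simp_all add: mult.commute[of R]\<close>)
    then show ?thesis using order_trans[OF * 1] \<tau>(1) by blast
  qed
  then show "\<exists>\<rho>. emb \<rho> \<and> \<eta> / 6 * c * (\<Sum>i<Suc r. \<bar>n i\<bar>) \<le> \<bar>\<Sum>i<Suc r. n i * ln (cmod (\<rho> ((w(r := u)) i)))\<bar>"
    unfolding N_def by simp
qed

lemma exists_emb: "\<exists>\<sigma> :: 'a::field_char_0 \<Rightarrow> complex. emb \<sigma>"
  using exists_emb_norm_ge_1[of "1 :: 'a"] by auto

text \<open>The descent from valuation rings repeated at complex embeddings. The fixed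
  \<open>s\<close> sets the precision \<open>1 / Q\<close> for all rounds while \<open>r\<close>
  counts down, since the independence constant \<open>(\<eta> / 6) ^ r\<close> is smallest at the
  largest rank.\<close>

lemma small_ratios_subset_robust:
  fixes A :: "'a::field_char_0 set"
  assumes \<eta>: "0 < \<eta>" "\<eta> \<le> 1" and Q: "1 / real Q \<le> (\<eta> / 6) ^ s / 4" "Q \<ge> 1" and k: "k \<ge> 1"
  shows "r \<le> s \<Longrightarrow> finite A \<Longrightarrow> 0 \<notin> A \<Longrightarrow> card (subset_sums A) \<le> 2 ^ k \<Longrightarrow>
    (\<And>x y. x \<in> A \<Longrightarrow> y \<in> A \<Longrightarrow> algebraic_int (x / y)) \<Longrightarrow>
    \<not> (\<exists>w. (\<forall>i<r. w i \<in> ratios A) \<and> robust_indep r ((\<eta> / 6) ^ r) w) \<Longrightarrow>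
    \<exists>B\<subseteq>A. card A \<le> (2 * k * Q) ^ r * card B \<and>
      (\<forall>x\<in>B. \<forall>y\<in>B. \<forall>\<sigma>. emb \<sigma> \<longrightarrow> \<bar>ln (cmod (\<sigma> (x / y)))\<bar> \<le> \<eta>)"
proof (induction r arbitrary: A)
  case 0
  then show ?case using exists_emb unfolding robust_indep_def by auto
next
  case (Suc r)
  note int = Suc.prems(5)
  show ?case
  proof (cases "\<forall>x\<in>A. \<forall>y\<in>A. \<forall>\<sigma>. emb \<sigma> \<longrightarrow> \<bar>ln (cmod (\<sigma> (x / y)))\<bar> \<le> \<eta>")
    case True
    have "(2 * k * Q) ^ Suc r \<ge> 1" using k Q(2) by simp
    then show ?thesis using True by (intro exI[of _ A]) auto
  next
    case False
    then obtain x y \<tau> where xy: "x \<in> A" "y \<in> A" and \<tau>: "emb \<tau>" "\<bar>ln (cmod (\<tau> (x / y)))\<bar> > \<eta>"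
      by (meson not_le)
    let ?S = "(\<lambda>z. \<bar>ln (cmod z)\<bar>) ` {\<sigma> (x / y) | \<sigma>. emb \<sigma>}"
    have fS: "finite ?S" using finite_emb_values[OF int[OF xy]] by simp
    then have "Max ?S \<in> ?S" using \<tau>(1) by (intro Max_in) auto
    then obtain \<sigma> where \<sigma>: "emb \<sigma>" "\<bar>ln (cmod (\<sigma> (x / y)))\<bar> = Max ?S" by auto
    have max: "\<bar>ln (cmod (\<rho> (x / y)))\<bar> \<le> \<bar>ln (cmod (\<sigma> (x / y)))\<bar>" if "emb \<rho>" for \<rho>
      unfolding \<sigma>(2) using that fS by (intro Max_ge) auto
    obtain B where B: "B \<subseteq> A" "card A \<le> 2 * k * Q * card B"
      "\<And>x y. x \<in> B \<Longrightarrow> y \<in> B \<Longrightarrow> \<bar>ln (cmod (\<sigma> (x / y)))\<bar> \<le> 1 / real Q"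
      using emb_classes[OF \<sigma>(1) Suc.prems(2-4) int Q(2)] by metis
    have "\<not> (\<exists>w. (\<forall>i<r. w i \<in> ratios B) \<and> robust_indep r ((\<eta> / 6) ^ r) w)"
    proof
      assume "\<exists>w. (\<forall>i<r. w i \<in> ratios B) \<and> robust_indep r ((\<eta> / 6) ^ r) w"
      then obtain w where w: "\<And>i. i < r \<Longrightarrow> w i \<in> ratios B" "robust_indep r ((\<eta> / 6) ^ r) w" by blast
      have "robust_indep (Suc r) (\<eta> / 6 * (\<eta> / 6) ^ r) (w(r := x / y))"
      proof (rule robust_indep_extend[where \<sigma> = \<sigma>, OF w(2) \<eta>])
        show "emb \<sigma>" by (rule \<sigma>)
        show "\<bar>ln (cmod (\<rho> (x / y)))\<bar> \<le> \<bar>ln (cmod (\<sigma> (x / y)))\<bar>" if "emb \<rho>" for \<rho>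
          by (rule max[OF that])
        show "\<eta> < \<bar>ln (cmod (\<sigma> (x / y)))\<bar>" using \<tau> max by fastforce
        show "0 < (\<eta> / 6) ^ r" "(\<eta> / 6) ^ r \<le> 1" using \<eta> by (auto intro: power_le_one)
        fix i assume "i < r"
        then have "\<bar>ln (cmod (\<sigma> (w i)))\<bar> \<le> 1 / real Q"
          using w(1)[of i] B(3) unfolding ratios_def by auto
        also have "\<dots> \<le> (\<eta> / 6) ^ s / 4" by (rule Q)
        also have "\<dots> \<le> (\<eta> / 6) ^ r / 4"
          using \<eta> Suc.prems(1) by (intro divide_right_mono power_decreasing) auto
        finally show "\<bar>ln (cmod (\<sigma> (w i)))\<bar> \<le> (\<eta> / 6) ^ r / 4" .
      qed
      moreover have "(w(r := x / y)) i \<in> ratios A" if "i < Suc r" for i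
        using w(1)[of i] that xy B(1) unfolding ratios_def by (auto simp: less_Suc_eq)
      ultimately show False using Suc.prems(6) unfolding power_Suc by blast
    qed
    moreover have "finite B" "0 \<notin> B" "r \<le> s" using B Suc.prems finite_subset by auto
    moreover have "card (subset_sums B) \<le> 2 ^ k"
      using card_mono[OF finite_subset_sums[OF Suc.prems(2)] subset_sums_mono[OF B(1)]] Suc.prems(4) by simp
    moreover have intB: "algebraic_int (x / y)" if "x \<in> B" "y \<in> B" for x y using int that B(1) by blast
    ultimately obtain C where C: "C \<subseteq> B" "card B \<le> (2 * k * Q) ^ r * card C"
      "\<forall>x\<in>C. \<forall>y\<in>C. \<forall>\<sigma>. emb \<sigma> \<longrightarrow> \<bar>ln (cmod (\<sigma> (x / y)))\<bar> \<le> \<eta>"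
      using Suc.IH[of B] intB by blast
    have "card A \<le> 2 * k * Q * ((2 * k * Q) ^ r * card C)" using B(2) C(2) by (meson le_trans mult_le_mono2)
    then show ?thesis using C B by (intro exI[of _ C]) (auto simp: mult_ac)
  qed
qed

lemma small_ratios_subset:
  fixes A :: "'a::field_char_0 set"
  assumes \<eta>: "0 < \<eta>" "\<eta> \<le> 1" and Q: "1 / real Q \<le> (\<eta> / 6) ^ r / 4" "Q \<ge> 1" and k: "k \<ge> 1"
    and A: "finite A" "0 \<notin> A" "card (subset_sums A) \<le> 2 ^ k"
    and int: "\<And>x y. x \<in> A \<Longrightarrow> y \<in> A \<Longrightarrow> algebraic_int (x / y)" and ind: "\<not> has_indep_ratios r A"
  shows "\<exists>B\<subseteq>A. card A \<le> (2 * k * Q) ^ r * card B \<and>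
      (\<forall>x\<in>B. \<forall>y\<in>B. \<forall>\<sigma>. emb \<sigma> \<longrightarrow> \<bar>ln (cmod (\<sigma> (x / y)))\<bar> \<le> \<eta>)"
proof (rule small_ratios_subset_robust[OF \<eta> Q k le_refl A int])
  show "\<not> (\<exists>w. (\<forall>i<r. w i \<in> ratios A) \<and> robust_indep r ((\<eta> / 6) ^ r) w)"
  proof
    assume "\<exists>w. (\<forall>i<r. w i \<in> ratios A) \<and> robust_indep r ((\<eta> / 6) ^ r) w"
    then obtain w where w: "\<And>i. i < r \<Longrightarrow> w i \<in> ratios A" "robust_indep r ((\<eta> / 6) ^ r) w" by blast
    have "mult_indep r w"
      by (rule robust_imp_mult_indep[OF w(2)]) (use \<eta> ratio_unit[OF int A(2) w(1)] in auto)
    then show False using ind w(1) unfolding has_indep_ratios_def by blast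
  qed
qed

section \<open>The lower bound\<close>

lemma card_le_mult_card_image:
  assumes "finite A" "\<And>y. y \<in> f ` A \<Longrightarrow> card {x\<in>A. f x = y} \<le> m"
  shows "card A \<le> m * card (f ` A)"
proof -
  have "card A = (\<Sum>y\<in>f ` A. card {x\<in>A. f x = y})"
    using assms(1) by (rule sum.group[of A "f ` A" f "\<lambda>_. 1::nat", simplified, symmetric])
  also have "\<dots> \<le> (\<Sum>y\<in>f ` A. m)" by (intro sum_mono assms(2))
  finally show ?thesis by (simp add: mult.commute)
qed

lemma card_power_eq_le:
  fixes b y :: "'a::field"
  assumes "finite B" "b \<noteq> 0" "q > 0"
  shows "card {x\<in>B. (x / b) ^ q = y} \<le> q"
proof -
  define p where "p = monom 1 q - [:y:]"
  have cp: "coeff p q = 1" unfolding p_def using assms(3) by (simp add: coeff_pCons split: nat.splits)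
  then have p0: "p \<noteq> 0" by auto
  have "degree p \<le> q" unfolding p_def by (intro degree_diff_le) (auto simp: degree_monom_le)
  moreover have "card {z. poly p z = 0} \<le> degree p" by (rule card_poly_roots_bound[OF p0])
  moreover have "card {x\<in>B. (x / b) ^ q = y} \<le> card {z. poly p z = 0}"
  proof (rule card_inj_on_le)
    show "inj_on (\<lambda>x. x / b) {x\<in>B. (x / b) ^ q = y}" using assms by (auto simp: inj_on_def)
    show "(\<lambda>x. x / b) ` {x\<in>B. (x / b) ^ q = y} \<subseteq> {z. poly p z = 0}"
      unfolding p_def by (auto simp: poly_monom)
    show "finite {z. poly p z = 0}" by (rule poly_roots_finite[OF p0])
  qed
  ultimately show ?thesis by linarith
qed

lemma has_indep_ratios_mono:
  assumes "B \<subseteq> A" "has_indep_ratios r B"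
  shows "has_indep_ratios r A"
proof -
  have "ratios B \<subseteq> ratios A" using assms(1) unfolding ratios_def by blast
  then show ?thesis using assms(2) unfolding has_indep_ratios_def by blast
qed

text \<open>The losses are \<open>2\<close> for low rank, \<open>k ^ r\<close> for integral ratios,
  \<open>(2 * k * Q) ^ r\<close> for small conjugates and \<open>q\<close> for keeping one element
  per value of \<open>(x / b) ^ q\<close>. The \<open>h\<close>-element subsets of the
  \<open>M\<close> survivors have distinct sums, because two equal sums would give a relation of at
  most \<open>2 * h\<close> terms. \<open>Q\<close> is the inverse of
  \<open>(\<eta> / 6) ^ r / 4\<close>.\<close>

lemma structured_subset_bound:
  fixes A :: "'a::field_char_0 set"
  assumes A: "finite A" "0 \<notin> A" and sums: "card (subset_sums A) \<le> 2 ^ k" "k \<ge> 1"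
    and prods: "card (subset_prods A) < L ^ r" and rL: "r \<ge> 1" "L \<ge> 1" "4 * r ^ 3 * L\<^sup>2 \<le> card A"
    and q: "q = fact (4 * h)" and X: "X = 1 + 2 * h * q" and Q: "Q = 4 * (12 * X) ^ r" and h: "h \<ge> 1"
  shows "\<exists>M. M choose h \<le> 2 ^ k \<and> card A \<le> 2 * (k ^ r * ((2 * k * Q) ^ r * (q * M)))"
proof -
  have sums': "card (subset_sums B) \<le> 2 ^ k" if "B \<subseteq> A" for B
    using card_mono[OF finite_subset_sums[OF A(1)] subset_sums_mono[OF that]] sums by simp
  obtain B1 where B1: "B1 \<subseteq> A" "card A \<le> 2 * card B1" "\<not> has_indep_ratios r B1"
    using low_rank_subset[OF A rL prods] by blast
  have fB1: "finite B1" "0 \<notin> B1" using B1 A finite_subset by auto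
  then obtain B2 where B2: "B2 \<subseteq> B1" "card B1 \<le> k ^ r * card B2"
      and int: "\<And>x y. x \<in> B2 \<Longrightarrow> y \<in> B2 \<Longrightarrow> algebraic_int (x / y)"
    using integral_ratios_subset[of B1 k r] sums'[OF B1(1)] sums(2) B1(3) by metis
  \<comment> \<open>Chosen so that exponents up to \<open>X\<close> keep conjugates below
    \<open>exp (1 / 2)\<close>, hence below 2.\<close>
  define \<eta> where "\<eta> = 1 / (2 * real X)"
  have X1: "real X \<ge> 1" unfolding X by simp
  have \<eta>: "0 < \<eta>" "\<eta> \<le> 1" unfolding \<eta>_def using X1 by auto
  have "\<eta> / 6 = 1 / (12 * real X)" unfolding \<eta>_def by simp
  then have "1 / real Q \<le> (\<eta> / 6) ^ r / 4" unfolding Q by (simp add: power_one_over)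
  moreover have "Q \<ge> 1" unfolding Q X by simp
  moreover have "finite B2" using B2(1) fB1(1) by (rule finite_subset)
  moreover have "0 \<notin> B2" "B2 \<subseteq> A" using B2(1) B1(1) fB1 by auto
  moreover have "\<not> has_indep_ratios r B2" using B1(3) has_indep_ratios_mono B2(1) by blast
  ultimately obtain B where B: "B \<subseteq> B2" "card B2 \<le> (2 * k * Q) ^ r * card B"
      and small: "\<And>x y \<sigma>. x \<in> B \<Longrightarrow> y \<in> B \<Longrightarrow> emb \<sigma> \<Longrightarrow> \<bar>ln (cmod (\<sigma> (x / y)))\<bar> \<le> \<eta>"
    using small_ratios_subset[OF \<eta> _ _ sums(2) _ _ sums' int] by metis
  have fB: "finite B" "0 \<notin> B" "B \<subseteq> A" using B \<open>finite B2\<close> \<open>0 \<notin> B2\<close> \<open>B2 \<subseteq> A\<close> finite_subset by auto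
  have chain: "card A \<le> 2 * (k ^ r * ((2 * k * Q) ^ r * card B))"
    using B1(2) B2(2) B(2) by (meson le_trans mult_le_mono2)
  show ?thesis
  proof (cases "B = {}")
    case True
    then show ?thesis using chain h by (intro exI[of _ 0]) (auto simp: binomial_eq_0)
  next
    case False
    then obtain b where b: "b \<in> B" by auto
    then have b0: "b \<noteq> 0" using fB by auto
    define f where "f x = (x / b) ^ q" for x
    obtain C where C: "C \<subseteq> B" "inj_on f C" "f ` B = f ` C" using subset_image_inj[of "f ` B" f B] by auto
    have fC: "finite C" using C fB finite_subset by auto
    have "card B \<le> q * card (f ` B)"
      unfolding f_def by (intro card_le_mult_card_image card_power_eq_le) (use fB b0 q in auto)
    also have "card (f ` B) = card C" using C by (simp add: card_image)
    finally have cB: "card B \<le> q * card C" .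
    have small': "cmod (\<sigma> (x / b)) ^ n \<le> 2" if \<sigma>: "emb \<sigma>" and x: "x \<in> B" and n: "n \<le> X" for \<sigma> x n
    proof -
      have "algebraic_int (x / b)" "x / b \<noteq> 0" using int x b b0 B(1) fB by auto
      then have pos: "cmod (\<sigma> (x / b)) > 0" using emb_eq_0_iff[OF \<sigma>] by auto
      have "ln (cmod (\<sigma> (x / b))) \<le> \<eta>" using small[OF x b \<sigma>] by simp
      then have "cmod (\<sigma> (x / b)) \<le> exp \<eta>" using pos by (metis exp_le_cancel_iff exp_ln)
      then have "cmod (\<sigma> (x / b)) ^ n \<le> exp \<eta> ^ n" by (intro power_mono) auto
      also have "\<dots> = exp (real n * \<eta>)" by (simp add: exp_of_nat_mult)
      also have "\<dots> \<le> exp (1 / 2)"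
      proof -
        have "real n * \<eta> \<le> real X * \<eta>" using n \<eta> by (intro mult_right_mono) auto
        also have "\<dots> = 1 / 2" unfolding \<eta>_def using X1 by simp
        finally show ?thesis by simp
      qed
      also have "\<dots> \<le> 2" using exp_bound[of "1 / 2"] by (simp add: power2_eq_square)
      finally show ?thesis .
    qed
    define \<F> where "\<F> = {S. S \<subseteq> C \<and> card S = h}"
    have "inj_on (\<lambda>S. \<Sum>S) \<F>"
    proof (rule inj_onI, rule ccontr)
      fix S T assume ST: "S \<in> \<F>" "T \<in> \<F>" and eq: "\<Sum>S = \<Sum>T" and ne: "S \<noteq> T"
      have fin: "finite S" "finite T" using ST fC finite_subset unfolding \<F>_def by auto
      obtain E \<epsilon> where E: "E \<subseteq> S \<union> T" "E \<noteq> {}" "\<forall>d\<in>E. \<epsilon> d \<in> {-1, 1::int}" "(\<Sum>d\<in>E. of_int (\<epsilon> d) * d) = 0"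
        using equal_sums_relation[OF fin eq ne] by blast
      have EC: "E \<subseteq> C" using E(1) ST unfolding \<F>_def by auto
      have "(\<Sum>x\<in>E. of_int (\<epsilon> x) * x) \<noteq> 0"
      proof (rule no_short_relation[where h = h and b = b])
        show "finite E" using EC fC finite_subset by auto
        show "E \<noteq> {}" by (rule E)
        have "card E \<le> card (S \<union> T)" using E(1) fin by (intro card_mono) auto
        also have "\<dots> \<le> card S + card T" by (rule card_Un_le)
        finally show "card E \<le> 2 * h" using ST unfolding \<F>_def by simp
        show "0 \<notin> E" using EC C fB by auto
        show "b \<noteq> 0" by (rule b0)
        show "algebraic_int (x / b)" if "x \<in> E" for x using int that EC C(1) B(1) b by blast
        show "\<epsilon> x \<in> {-1, 1}" if "x \<in> E" for x using E(3) that by blast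
        show "inj_on (\<lambda>x. (x / b) ^ fact (4 * h)) E"
          using C(2) EC inj_on_subset unfolding f_def q by blast
        show "cmod (\<sigma> (x / b)) ^ n \<le> 2" if "emb \<sigma>" "x \<in> E" "n \<le> 1 + 2 * h * fact (4 * h)" for \<sigma> x n
          by (rule small'[OF that(1)]) (use that EC C(1) X q in auto)
      qed
      then show False using E(4) by simp
    qed
    moreover have "(\<lambda>S. \<Sum>S) ` \<F> \<subseteq> subset_sums A"
      unfolding \<F>_def subset_sums_def using C(1) fB(3) by auto
    ultimately have "card \<F> \<le> card (subset_sums A)"
      using A by (intro card_inj_on_le) auto
    then have "card C choose h \<le> 2 ^ k"
      using n_subsets[OF fC, of h] sums(1) unfolding \<F>_def by simp
    moreover have "card A \<le> 2 * (k ^ r * ((2 * k * Q) ^ r * (q * card C)))"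
      using chain cB by (meson le_trans mult_le_mono2)
    ultimately show ?thesis by blast
  qed
qed

text \<open>The binomial coefficient is at least \<open>sqrt N ^ h\<close>. A factor 4 in place of 5
  would only give equality with \<open>N ^ (2 * T)\<close>.\<close>

lemma binomial_gt_power:
  fixes N :: real and h T M :: nat
  assumes N: "N > 1" and T: "T \<ge> 1" and h: "h = 5 * T" and M: "real h * sqrt N \<le> real M"
  shows "N ^ (2 * T) < real (M choose h)"
proof -
  have sq: "sqrt N > 1" using N by simp
  have hpos: "real h > 0" using h T by simp
  have "real h * 1 \<le> real h * sqrt N" using sq by (intro mult_left_mono) auto
  then have hM: "h \<le> M" using M by linarith
  have "N ^ (2 * T) = (sqrt N ^ 2) ^ (2 * T)" using N by simp
  also have "\<dots> = sqrt N ^ (4 * T)" by (simp flip: power_mult)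
  also have "\<dots> < sqrt N ^ h" using sq T unfolding h by (intro power_strict_increasing) auto
  also have "\<dots> \<le> (real M / real h) ^ h"
    using M hpos sq by (intro power_mono) (auto simp: field_simps)
  also have "\<dots> \<le> real (M choose h)" by (rule binomial_ge_n_over_k_pow_k[OF hM])
  finally show ?thesis .
qed

text \<open>With \<open>y = ln (ln N)\<close>, all losses incurred in passing to the structured subset amount to
  \<open>exp (O(y\<^sup>3))\<close>, which is negligible against \<open>N = exp (exp y)\<close>.\<close>

lemma sums_or_products_large:
  fixes A :: "'a::field_char_0 set" and y :: real
  assumes A: "finite A" "card A = N" and T: "T \<ge> 1" "real (5 * T) \<le> y" and y: "y \<ge> 1"
    and N: "real N = exp (exp y)" and q: "fact (20 * T) \<le> exp y"
    and E1: "1 + 2 * y * exp y \<le> exp (2 * y)"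
    and E2: "4 * exp ((ln 12 + 2 * y) * y) \<le> exp (3 * y\<^sup>2)"
    and E3: "y * (exp y / ln 2 + 1) \<le> exp (2 * y)"
    and E4: "4 * y ^ 3 * (4 * exp (2 * exp y / 5)) \<le> exp (exp y) - 1"
    and E5: "2 * (exp ((ln 2 + 4 * y + 3 * y\<^sup>2) * y) * (exp y * (y * exp (exp y / 2)))) < exp (exp y) - 1"
  shows "N ^ T \<le> card (subset_sums A) + card (subset_prods A)"
proof (rule ccontr)
  assume "\<not> ?thesis"
  then have small: "card (subset_sums A) < N ^ T" "card (subset_prods A) < N ^ T" by auto
  \<comment> \<open>Multiplicative arguments need nonzero elements; the one element lost is the
    \<open>- 1\<close> in \<open>E4\<close> and \<open>E5\<close>.\<close>
  define A0 where "A0 = A - {0}"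
  have A0: "finite A0" "0 \<notin> A0" "A0 \<subseteq> A" unfolding A0_def using A by auto
  have "card A \<le> card A0 + 1" unfolding A0_def using A(1) by (simp add: card_Diff_singleton_if) arith
  then have cA0: "real (card A0) \<ge> exp (exp y) - 1" using A(2) N by linarith
  have N1: "real N > 1" unfolding N by simp
  then have Npos: "N > 0" by linarith
  have lnN: "ln (real N) = exp y" unfolding N by simp
  define m where "m = nat \<lceil>log 2 (real N)\<rceil>"
  have log0: "log 2 (real N) > 0" using N1 by simp
  have m: "log 2 (real N) \<le> real m" "real m < log 2 (real N) + 1" unfolding m_def using log0 by linarith+
  have m1: "m \<ge> 1" using m(1) log0 by linarith
  have "real N = 2 powr log 2 (real N)" using Npos by simp
  also have "\<dots> \<le> 2 powr real m" using m by (intro powr_mono) auto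
  finally have N2m: "real N \<le> 2 ^ m" by (simp add: powr_realpow)
  have "2 powr real m \<le> 2 powr (log 2 (real N) + 1)" using m by (intro powr_mono) auto
  then have m2N: "2 ^ m \<le> 2 * real N" using Npos by (simp add: powr_realpow powr_add)
  \<comment> \<open>As \<open>m\<close> is the binary logarithm of \<open>N\<close> rounded up,
    \<open>2 ^ k\<close> lies between \<open>N ^ T\<close> and \<open>(2 * N) ^ T\<close>.\<close>
  define k where "k = T * m"
  have k1: "k \<ge> 1" using T m1 unfolding k_def by simp
  have "real (N ^ T) \<le> (2 ^ m) ^ T" using N2m by (simp add: power_mono)
  also have "\<dots> = real (2 ^ k)" unfolding k_def by (simp add: mult.commute flip: power_mult)
  finally have NT: "N ^ T \<le> 2 ^ k" by linarith
  have sums: "card (subset_sums A0) \<le> 2 ^ k"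
    using card_mono[OF finite_subset_sums[OF A(1)] subset_sums_mono[OF A0(3)]] small(1) NT by simp
  define r where "r = 5 * T"
  have r: "r \<ge> 1" "real r \<le> y" unfolding r_def using T by auto
  have ry: "real r * z \<le> z * y" if "z \<ge> 0" for z
    using mult_right_mono[OF r(2) that] by (simp add: mult.commute)
  \<comment> \<open>About the fifth root of \<open>N\<close>: then \<open>L ^ r\<close> reaches
    \<open>N ^ T\<close>, while \<open>L\<^sup>2\<close> is only of order \<open>N\<close> to the
    power 2/5 and leaves room for the blocks of the product set.\<close>
  define L where "L = nat \<lceil>exp (exp y / 5)\<rceil>"
  have L: "exp (exp y / 5) \<le> real L" "real L < exp (exp y / 5) + 1" 
    unfolding L_def using exp_gt_zero[of "exp y / 5"] by linarith+
  have e1: "exp (exp y / 5) \<ge> 1" by simp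
  have L1: "L \<ge> 1" and L2: "real L \<le> 2 * exp (exp y / 5)" using L e1 by linarith+
  have "real N = exp (exp y / 5) ^ 5" unfolding N by (simp flip: exp_of_nat_mult)
  also have "\<dots> \<le> real L ^ 5" using L(1) by (intro power_mono) auto
  finally have NL: "N \<le> L ^ 5" by (metis of_nat_le_iff of_nat_power)
  have "N ^ T \<le> (L ^ 5) ^ T" using NL by (rule power_mono) simp
  then have NLr: "N ^ T \<le> L ^ r" unfolding r_def by (simp flip: power_mult)
  have prods: "card (subset_prods A0) < L ^ r"
    using card_mono[OF finite_subset_prods[OF A(1)] subset_prods_mono[OF A0(3)]] small(2) NLr by simp
  have "real (4 * r ^ 3 * L\<^sup>2) = 4 * real r ^ 3 * real L ^ 2" by simp
  also have "\<dots> \<le> 4 * y ^ 3 * (2 * exp (exp y / 5)) ^ 2"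
    using r y L2 by (intro mult_mono power_mono) auto
  also have "(2 * exp (exp y / 5)) ^ 2 = 4 * exp (2 * exp y / 5)"
    by (simp add: power_mult_distrib flip: exp_of_nat_mult)
  finally have "real (4 * r ^ 3 * L\<^sup>2) \<le> real (card A0)" using E4 cA0 by linarith
  then have big: "4 * r ^ 3 * L\<^sup>2 \<le> card A0" by linarith
  define q' X Q :: nat where "q' = fact (4 * r)" and "X = 1 + 2 * r * q'" and "Q = 4 * (12 * X) ^ r"
  obtain M where M: "M choose r \<le> 2 ^ k" "card A0 \<le> 2 * (k ^ r * ((2 * k * Q) ^ r * (q' * M)))"
    using structured_subset_bound[OF A0(1,2) sums k1 prods r(1) L1 big q'_def X_def Q_def r(1)] by blast
  have qy: "real q' \<le> exp y"
    using q unfolding q'_def r_def by (simp add: of_nat_fact)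
  have "real X \<le> 1 + 2 * y * exp y"
    unfolding X_def using r(2) qy y by (simp add: mult_mono)
  then have Xy: "real X \<le> exp (2 * y)" using E1 by linarith
  have "real Q = 4 * (12 * real X) ^ r" unfolding Q_def by simp
  also have "\<dots> \<le> 4 * (12 * exp (2 * y)) ^ r" using Xy by (intro mult_left_mono power_mono) auto
  also have "12 * exp (2 * y) = exp (ln 12 + 2 * y)" by (simp add: exp_add)
  also have "exp (ln 12 + 2 * y) ^ r = exp (real r * (ln 12 + 2 * y))" by (simp only: exp_of_nat_mult)
  also have "4 * \<dots> \<le> 4 * exp ((ln 12 + 2 * y) * y)"
    using ry[of "ln 12 + 2 * y"] y by simp
  finally have Qy: "real Q \<le> exp (3 * y\<^sup>2)" using E2 by linarith
  have "real k \<le> y * (exp y / ln 2 + 1)"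
    unfolding k_def of_nat_mult
  proof (rule mult_mono)
    show "real T \<le> y" using T by simp
    show "real m \<le> exp y / ln 2 + 1" using m(2) unfolding log_def lnN by linarith
  qed (use y in auto)
  then have ky: "real k \<le> exp (2 * y)" using E3 by linarith
  have "real (k ^ r * (2 * k * Q) ^ r) = (2 * (real k * real k) * real Q) ^ r"
    by (simp add: power_mult_distrib mult_ac)
  also have "\<dots> \<le> (2 * (exp (2 * y) * exp (2 * y)) * exp (3 * y\<^sup>2)) ^ r"
    using ky Qy by (intro power_mono mult_mono) auto
  also have "2 * (exp (2 * y) * exp (2 * y)) * exp (3 * y\<^sup>2) = exp (ln 2 + 4 * y + 3 * y\<^sup>2)"
    by (simp add: exp_add flip: exp_add[of "2 * y" "2 * y"])
  also have "exp (ln 2 + 4 * y + 3 * y\<^sup>2) ^ r = exp (real r * (ln 2 + 4 * y + 3 * y\<^sup>2))"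
    by (simp only: exp_of_nat_mult)
  also have "\<dots> \<le> exp ((ln 2 + 4 * y + 3 * y\<^sup>2) * y)"
    using ry[of "ln 2 + 4 * y + 3 * y\<^sup>2"] y by simp
  finally have loss: "real (k ^ r * (2 * k * Q) ^ r) \<le> exp ((ln 2 + 4 * y + 3 * y\<^sup>2) * y)" .
  have "real M < real r * sqrt (real N)"
  proof (rule ccontr)
    assume "\<not> ?thesis"
    then have "real N ^ (2 * T) < real (M choose r)"
      by (intro binomial_gt_power[OF N1 T(1) r_def]) simp
    also have "\<dots> \<le> real (2 ^ k)" using M(1) by (rule of_nat_mono)
    also have "\<dots> = (2 ^ m) ^ T" unfolding k_def by (simp add: mult.commute flip: power_mult)
    also have "\<dots> \<le> (2 * real N) ^ T" using m2N by (intro power_mono) auto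
    also have "\<dots> \<le> (real N ^ 2) ^ T"
    proof (rule power_mono)
      have "N \<ge> 2" using N1 by linarith
      then show "2 * real N \<le> real N ^ 2" by (simp add: power2_eq_square)
    qed simp
    finally show False by (simp flip: power_mult)
  qed
  moreover have "sqrt (real N) = exp (exp y / 2)"
    unfolding N by (rule real_sqrt_unique) (simp_all flip: exp_of_nat_mult)
  moreover have "real r * sqrt (real N) \<le> y * sqrt (real N)" using r(2) by (intro mult_right_mono) auto
  ultimately have My: "real M \<le> y * exp (exp y / 2)" by (metis less_imp_le less_le_trans)
  have "real (card A0) \<le> real (2 * (k ^ r * ((2 * k * Q) ^ r * (q' * M))))" using M(2) by (rule of_nat_mono)
  also have "\<dots> = 2 * (real (k ^ r * (2 * k * Q) ^ r) * (real q' * real M))" by (simp add: mult_ac)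
  also have "\<dots> \<le> 2 * (exp ((ln 2 + 4 * y + 3 * y\<^sup>2) * y) * (exp y * (y * exp (exp y / 2))))"
    using loss qy My y by (intro mult_left_mono mult_mono) auto
  finally show False using cA0 E5 by linarith
qed

section \<open>Passage to \<open>g_K\<close> and choice of parameters\<close>

lemma g_K_ge:
  assumes "\<And>A :: 'a::field_char_0 set. finite A \<Longrightarrow> card A = N \<Longrightarrow>
    m \<le> card (subset_sums A) + card (subset_prods A)"
  shows "m \<le> g_K TYPE('a) N"
proof -
  let ?P = "\<lambda>k. \<exists>A :: 'a set. finite A \<and> card A = N \<and> k = card (subset_sums A) + card (subset_prods A)"
  \<comment> \<open>\<open>LEAST\<close> is informative only if a candidate exists; a field of
    characteristic 0 is infinite and has subsets of every finite size.\<close>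
  obtain A :: "'a set" where "finite A" "card A = N"
    using infinite_arbitrarily_large[OF infinite_UNIV_char_0] by blast
  then have "?P (card (subset_sums A) + card (subset_prods A))" by blast
  then have "?P (g_K TYPE('a) N)" unfolding g_K_def by (rule LeastI)
  then show ?thesis using assms by auto
qed

text \<open>The binding condition is \<open>fact (20 * T) \<le> exp y\<close>, with
  \<open>20 * T = 4 * h\<close>; bounding the factorial by a power reduces it to
  \<open>20 * T * ln y \<le> y\<close>. Rounding \<open>y / (264 * ln y)\<close> up stays within
  this range for large \<open>y\<close>.\<close>

lemma eventually_parameters:
  "\<forall>\<^sub>F y::real in at_top. \<exists>T::nat. T \<ge> 1 \<and> y / (264 * ln y) \<le> real T \<and> real (5 * T) \<le> y \<and>
     fact (20 * T) \<le> exp y"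
proof -
  have "\<forall>\<^sub>F y::real in at_top. y / (264 * ln y) + 1 \<le> y / (20 * ln y)" by real_asymp
  moreover have "\<forall>\<^sub>F y::real in at_top. ln y \<ge> 1" by real_asymp
  ultimately show ?thesis using eventually_gt_at_top[of 1]
  proof eventually_elim
    case (elim y)
    define T where "T = nat \<lceil>y / (264 * ln y)\<rceil>"
    have pos: "y / (264 * ln y) > 0" using elim by simp
    have T: "y / (264 * ln y) \<le> real T" "real T < y / (264 * ln y) + 1" unfolding T_def using pos by linarith+
    have T1: "T \<ge> 1" using T(1) pos by linarith
    have "real T \<le> y / (20 * ln y)" using T(2) elim by linarith
    then have a: "20 * real T * ln y \<le> y" using elim by (simp add: field_simps)
    have "20 * real T * 1 \<le> 20 * real T * ln y" using elim by (intro mult_left_mono) auto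
    then have b: "20 * real T \<le> y" using a by linarith
    have "fact (20 * T) \<le> real ((20 * T) ^ (20 * T))" using fact_le_power[of "20 * T", where 'a=real] by simp
    also have "\<dots> \<le> y ^ (20 * T)" unfolding of_nat_power using b by (intro power_mono) auto
    also have "\<dots> = exp (ln y) ^ (20 * T)" using elim by simp
    also have "\<dots> = exp (20 * real T * ln y)" by (simp only: exp_of_nat_mult[symmetric]) simp
    also have "\<dots> \<le> exp y" using a by simp
    finally show ?case using T T1 b by (intro exI[of _ T]) auto
  qed
qed

theorem theorem1:
  fixes \<epsilon> :: real
  assumes "\<epsilon> > 0"
  shows "\<forall>\<^sub>F N in sequentially.
           real (g_K TYPE('a::{alg_closed_field, field_char_0}) N)
             \<ge> real N powr ((1/264 - \<epsilon>) * ln (ln (real N)) / ln (ln (ln (real N))))"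
proof -
  have lim: "filterlim (\<lambda>N. ln (ln (real N))) at_top sequentially" by real_asymp
  have "\<forall>\<^sub>F y::real in at_top. 1 + 2 * y * exp y \<le> exp (2 * y)" by real_asymp
  moreover have "\<forall>\<^sub>F y::real in at_top. 4 * exp ((ln 12 + 2 * y) * y) \<le> exp (3 * y\<^sup>2)" by real_asymp
  moreover have "\<forall>\<^sub>F y::real in at_top. y * (exp y / ln 2 + 1) \<le> exp (2 * y)" by real_asymp
  moreover have "\<forall>\<^sub>F y::real in at_top. 4 * y ^ 3 * (4 * exp (2 * exp y / 5)) \<le> exp (exp y) - 1" by real_asymp
  moreover have "\<forall>\<^sub>F y::real in at_top.
      2 * (exp ((ln 2 + 4 * y + 3 * y\<^sup>2) * y) * (exp y * (y * exp (exp y / 2)))) < exp (exp y) - 1" by real_asymp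
  ultimately have "\<forall>\<^sub>F y::real in at_top. y > 1 \<and> 1 + 2 * y * exp y \<le> exp (2 * y) \<and>
      4 * exp ((ln 12 + 2 * y) * y) \<le> exp (3 * y\<^sup>2) \<and> y * (exp y / ln 2 + 1) \<le> exp (2 * y) \<and>
      4 * y ^ 3 * (4 * exp (2 * exp y / 5)) \<le> exp (exp y) - 1 \<and>
      2 * (exp ((ln 2 + 4 * y + 3 * y\<^sup>2) * y) * (exp y * (y * exp (exp y / 2)))) < exp (exp y) - 1 \<and>
      (\<exists>T::nat. T \<ge> 1 \<and> y / (264 * ln y) \<le> real T \<and> real (5 * T) \<le> y \<and> fact (20 * T) \<le> exp y)"
    using eventually_parameters eventually_gt_at_top[of 1] by eventually_elim simp
  \<comment> \<open>The conditions on large real \<open>y\<close> are pulled back along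
    \<open>y = ln (ln N)\<close>.\<close>
  from filterlim_iff[THEN iffD1, OF lim, rule_format, OF this] eventually_gt_at_top[of 1]
  show ?thesis
  proof eventually_elim
    case (elim N)
    define y where "y = ln (ln (real N))"
    from elim obtain T :: nat where T: "T \<ge> 1" "y / (264 * ln y) \<le> real T" "real (5 * T) \<le> y"
      "fact (20 * T) \<le> exp y" and y: "y > 1" unfolding y_def by blast
    have "ln (real N) > 0" using elim by simp
    then have N: "real N = exp (exp y)" unfolding y_def using elim by simp
    have le: "N ^ T \<le> g_K TYPE('a) N"
      by (rule g_K_ge, rule sums_or_products_large[where y = y])
        (use elim T y N in \<open>simp_all add: y_def[symmetric]\<close>)
    have "(1/264 - \<epsilon>) * y / ln y \<le> 1/264 * y / ln y"
      using y assms by (intro divide_right_mono mult_right_mono) auto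
    also have "\<dots> \<le> real T" using T(2) by simp
    finally have "real N powr ((1/264 - \<epsilon>) * y / ln y) \<le> real N powr real T"
      using elim by (intro powr_mono) auto
    also have "\<dots> = real (N ^ T)" using elim by (simp add: powr_realpow)
    also have "\<dots> \<le> real (g_K TYPE('a) N)" using le by (rule of_nat_mono)
    finally show ?case unfolding y_def .
  qed
qed

end
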